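(* Let $q$ be a prime and let $\mathcal{S}$ be a stabilizer code with parameters $[[n,k,d]]_q$. Then $\mathcal{S}$ can be transformed into an $[[n,k,d']]_{\mathbb{Z}}$ stabilizer code with $d'=d^*\geq d$.
   Context: For prime $q$, qudit Paulis are generated by $X|j\rangle=|j+1 \bmod q\rangle$, $Z|j\rangle=e^{2\pi ij/q}|j\rangle$. Over $\mathbb{Z}$ (infinite discrete local-dimension, basis $|j\rangle$, $j\in\mathbb{Z}$), Paulis are generated by $X|j\rangle=|j+1\rangle$, $X^{-1}|j\rangle=|j-1\rangle$, $Z|j\rangle=\omega_\infty^j|j\rangle$ with $\omega_\infty=e^{2\pi i/\sqrt2}$. An $n$-register Pauli $\bigotimes_t X^{a_t}Z^{b_t}$ has integer representation $\phi_\infty=(\vec a|\vec b)\in\mathbb{Z}^{2n}$; the symplectic product is $(\vec a|\vec b)\odot(\vec a'|\vec b')=\vec a\cdot\vec b'-\vec a'\cdot\vec b$. A stabilizer code $[[n,k,d]]$ has $n$ physical registers, $k$ logical registers, and distance $d$ equal to the minimum weight (number of non-identity factors) of a Pauli commuting with all stabilizers but not in the stabilizer group (over $\mathbb{Z}$, commuting means integer symplectic product exactly $0$). A local-dimension-invariant (LDI) form of $\mathcal{S}$ is a set of integer generator vectors congruent modulo $q$ to generators of $\mathcal{S}$ with pairwise integer symplectic products exactly $0$; the $\mathbb{Z}$ code is the one generated by this LDI form. An unavoidable error is a Pauli (not in the stabilizer group) whose integer symplectic product with each LDI generator is exactly $0$; $d^*$ is the minimal weight of an unavoidable error. *)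

theory Defs
  imports Main "HOL-Computational_Algebra.Primes"
begin

text \<open>An n-register Pauli (up to phase) is represented by its integer vector
  (a|b) of length 2n, stored as an int list: entries 0..n-1 are a, entries n..2n-1 are b.\<close>

definition symp :: "nat \<Rightarrow> int list \<Rightarrow> int list \<Rightarrow> int" where
  "symp n u v = (\<Sum>t<n. u!t * v!(n+t) - v!t * u!(n+t))"

definition pweight :: "nat \<Rightarrow> int list \<Rightarrow> nat" where
  "pweight n u = card {t. t < n \<and> (u!t \<noteq> 0 \<or> u!(n+t) \<noteq> 0)}"

definition is_pauli_q :: "int \<Rightarrow> nat \<Rightarrow> int list \<Rightarrow> bool" where
  "is_pauli_q q n v \<longleftrightarrow> length v = 2*n \<and> (\<forall>x\<in>set v. 0 \<le> x \<and> x < q)"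

definition in_stab_q :: "int \<Rightarrow> nat \<Rightarrow> int list list \<Rightarrow> int list \<Rightarrow> bool" where
  "in_stab_q q n gens v \<longleftrightarrow>
     (\<exists>c :: nat \<Rightarrow> int. \<forall>i<2*n.
        v!i mod q = (\<Sum>j<length gens. c j * (gens!j)!i) mod q)"

definition indep_q :: "int \<Rightarrow> nat \<Rightarrow> int list list \<Rightarrow> bool" where
  "indep_q q n gens \<longleftrightarrow>
     (\<forall>c :: nat \<Rightarrow> int. (\<forall>i<2*n. (\<Sum>j<length gens. c j * (gens!j)!i) mod q = 0)
        \<longrightarrow> (\<forall>j<length gens. c j mod q = 0))"

definition stab_code_q :: "int \<Rightarrow> nat \<Rightarrow> nat \<Rightarrow> int list list \<Rightarrow> bool" where
  "stab_code_q q n k gens \<longleftrightarrow> k \<le> n \<and> length gens = n - k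
     \<and> (\<forall>g\<in>set gens. is_pauli_q q n g)
     \<and> (\<forall>g\<in>set gens. \<forall>h\<in>set gens. symp n g h mod q = 0)
     \<and> indep_q q n gens"

definition logical_q :: "int \<Rightarrow> nat \<Rightarrow> int list list \<Rightarrow> int list \<Rightarrow> bool" where
  "logical_q q n gens v \<longleftrightarrow> is_pauli_q q n v
     \<and> (\<forall>g\<in>set gens. symp n v g mod q = 0) \<and> \<not> in_stab_q q n gens v"

definition has_distance_q :: "int \<Rightarrow> nat \<Rightarrow> int list list \<Rightarrow> nat \<Rightarrow> bool" where
  "has_distance_q q n gens d \<longleftrightarrow>
     (\<exists>v. logical_q q n gens v \<and> pweight n v = d)
     \<and> (\<forall>v. logical_q q n gens v \<longrightarrow> d \<le> pweight n v)"

definition in_stab_Z :: "nat \<Rightarrow> int list list \<Rightarrow> int list \<Rightarrow> bool" where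
  "in_stab_Z n L v \<longleftrightarrow>
     (\<exists>c :: nat \<Rightarrow> int. \<forall>i<2*n. v!i = (\<Sum>j<length L. c j * (L!j)!i))"

definition indep_Z :: "nat \<Rightarrow> int list list \<Rightarrow> bool" where
  "indep_Z n L \<longleftrightarrow>
     (\<forall>c :: nat \<Rightarrow> int. (\<forall>i<2*n. (\<Sum>j<length L. c j * (L!j)!i) = 0)
        \<longrightarrow> (\<forall>j<length L. c j = 0))"

definition stab_code_Z :: "nat \<Rightarrow> nat \<Rightarrow> int list list \<Rightarrow> bool" where
  "stab_code_Z n k L \<longleftrightarrow> k \<le> n \<and> length L = n - k
     \<and> (\<forall>g\<in>set L. length g = 2*n)
     \<and> (\<forall>g\<in>set L. \<forall>h\<in>set L. symp n g h = 0)
     \<and> indep_Z n L"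

definition logical_Z :: "nat \<Rightarrow> int list list \<Rightarrow> int list \<Rightarrow> bool" where
  "logical_Z n L v \<longleftrightarrow> length v = 2*n
     \<and> (\<forall>g\<in>set L. symp n v g = 0) \<and> \<not> in_stab_Z n L v"

definition has_distance_Z :: "nat \<Rightarrow> int list list \<Rightarrow> nat \<Rightarrow> bool" where
  "has_distance_Z n L d \<longleftrightarrow>
     (\<exists>v. logical_Z n L v \<and> pweight n v = d)
     \<and> (\<forall>v. logical_Z n L v \<longrightarrow> d \<le> pweight n v)"

definition LDI_form :: "int \<Rightarrow> nat \<Rightarrow> int list list \<Rightarrow> int list list \<Rightarrow> bool" where
  "LDI_form q n gens L \<longleftrightarrow> length L = length gens
     \<and> (\<forall>j<length L. length (L!j) = 2*n \<and>
          (\<forall>i<2*n. (L!j)!i mod q = (gens!j)!i mod q))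
     \<and> (\<forall>g\<in>set L. \<forall>h\<in>set L. symp n g h = 0)"

definition unavoidable_error :: "nat \<Rightarrow> int list list \<Rightarrow> int list \<Rightarrow> bool" where
  "unavoidable_error n L e \<longleftrightarrow> length e = 2*n
     \<and> \<not> in_stab_Z n L e \<and> (\<forall>g\<in>set L. symp n e g = 0)"

definition d_star :: "nat \<Rightarrow> int list list \<Rightarrow> nat" where
  "d_star n L = (LEAST w. \<exists>e. unavoidable_error n L e \<and> pweight n e = w)"

end

theory Submission
  imports Defs "HOL-Number_Theory.Cong" "HOL-Computational_Algebra.Polynomial" "HOL-Library.FuncSet"
begin

text \<open>Write \<open>r = n - k\<close>. The quantum Singleton bound gives \<open>d \<le> r div 2 + 1\<close>, also for degenerate
  codes. For those an arbitrary integer lift would not suffice, since an unavoidable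
  error may reduce to a low-weight stabilizer. Instead the lift is chosen pure: integer
  transvections act transitively on isotropic frames modulo any prime, and those with multipliers
  divisible by \<open>m\<close> are the identity modulo \<open>m\<close>, so one obtains an exactly isotropic integer frame
  that is congruent to the given generators modulo \<open>q\<close> and to a quantum Reed-Solomon frame modulo
  another prime \<open>p > n\<close>. Every nonzero integer vector commuting with the latter has weight at least
  \<open>r div 2 + 1\<close>.\<close>

section \<open>Symplectic transvections\<close>

text \<open>The output must be isotropic exactly, while both targets are known only up to
  congruence. Integer transvections separate the two demands: they preserve the integer form, so the
  image of the standard X frame is isotropic whatever the multipliers are, and only residues remain
  to be steered. This is strong approximation for the symplectic group at two primes, made explicit.
  Reed-Solomon frames are chosen because their distance modulo \<open>p\<close> reaches
  \<open>r div 2 + 1\<close>, the largest value that the Singleton bound permits; the lifted frame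
  therefore does at least as well as any code with the same \<open>r\<close>, and the distance of
  the given code never has to be transported through the lift. The case \<open>r = n\<close> has to
  be excluded separately: such a code is its own commutant, so it has no logical operator and no
  distance.\<close>

definition symf :: "nat \<Rightarrow> (nat \<Rightarrow> int) \<Rightarrow> (nat \<Rightarrow> int) \<Rightarrow> int" where
  "symf n u v = (\<Sum>t<n. u t * v (n + t) - v t * u (n + t))"

text \<open>Vectors are functions on all of \<open>nat\<close>; entries from \<open>2*n\<close> on
  carry no meaning.\<close>

definition vcong :: "int \<Rightarrow> nat \<Rightarrow> (nat \<Rightarrow> int) \<Rightarrow> (nat \<Rightarrow> int) \<Rightarrow> bool" where
  "vcong q n x y \<longleftrightarrow> (\<forall>i<2*n. [x i = y i] (mod q))"

definition unit_vec :: "nat \<Rightarrow> nat \<Rightarrow> int" where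
  "unit_vec j = (\<lambda>i. if i = j then 1 else 0)"

text \<open>The sign is chosen so that pairing on the right reads off entry \<open>i\<close> itself;
  thus every coordinate functional is a symplectic product.\<close>

definition coord_vec :: "nat \<Rightarrow> nat \<Rightarrow> nat \<Rightarrow> int" where
  "coord_vec n i = (if i < n then unit_vec (n + i) else (\<lambda>j. - unit_vec (i - n) j))"

definition lin_indep_mod :: "int \<Rightarrow> nat \<Rightarrow> nat \<Rightarrow> (nat \<Rightarrow> nat \<Rightarrow> int) \<Rightarrow> bool" where
  "lin_indep_mod q n r x \<longleftrightarrow>
     (\<forall>c. (\<forall>i<2*n. q dvd (\<Sum>j<r. c j * x j i)) \<longrightarrow> (\<forall>j<r. q dvd c j))"

definition isotropic_mod :: "int \<Rightarrow> nat \<Rightarrow> nat \<Rightarrow> (nat \<Rightarrow> nat \<Rightarrow> int) \<Rightarrow> bool" where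
  "isotropic_mod q n r x \<longleftrightarrow> (\<forall>i<r. \<forall>j<r. q dvd symf n (x i) (x j))"

lemma symp_eq_symf: "symp n u v = symf n ((!) u) ((!) v)"
  by (simp add: symp_def symf_def)

lemma symf_cong: "(\<And>i. i < 2*n \<Longrightarrow> u i = u' i) \<Longrightarrow> (\<And>i. i < 2*n \<Longrightarrow> v i = v' i)
   \<Longrightarrow> symf n u v = symf n u' v'"
  by (auto simp: symf_def intro!: sum.cong)

lemma symf_swap: "symf n u v = - symf n v u"
  by (simp add: symf_def sum_negf[symmetric])

lemma symf_self [simp]: "symf n u u = 0"
  by (simp add: symf_def)

lemma symf_add_right: "symf n u (\<lambda>i. x i + c * y i) = symf n u x + c * symf n u y"
  by (simp add: symf_def sum.distrib[symmetric] sum_distrib_left algebra_simps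
      flip: sum_subtractf)

lemma symf_add_left: "symf n (\<lambda>i. x i + c * y i) u = symf n x u + c * symf n y u"
  using symf_add_right[of n u x c y] by (simp add: symf_swap[of n _ u])

lemma symf_diff_right: "symf n u (\<lambda>i. x i - y i) = symf n u x - symf n u y"
  using symf_add_right[of n u x "-1" y] by simp

lemma symf_zero_left [simp]: "symf n (\<lambda>i. 0) u = 0"
  by (simp add: symf_def)

lemma symf_sum_left:
  "symf n (\<lambda>i. \<Sum>j<(r::nat). c j * x j i) u = (\<Sum>j<r. c j * symf n (x j) u)"
proof (induction r)
  case (Suc r)
  then show ?case using symf_add_left[of n "\<lambda>i. \<Sum>j<r. c j * x j i" "c r" "x r" u] by simp
qed simp

lemma symf_sum_right:
  "symf n u (\<lambda>i. \<Sum>j<(r::nat). c j * x j i) = (\<Sum>j<r. c j * symf n u (x j))"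
  by (simp add: symf_swap[of n u] symf_sum_left sum_negf)

lemma symf_vcong:
  assumes "vcong q n u u'" "vcong q n v v'"
  shows "[symf n u v = symf n u' v'] (mod q)"
  unfolding symf_def using assms
  by (intro cong_sum cong_diff cong_mult) (auto simp: vcong_def)

lemma symf_coord:
  assumes "i < 2*n"
  shows "symf n x (coord_vec n i) = x i"
proof (cases "i < n")
  case True
  have "symf n x (coord_vec n i) = (\<Sum>t<n. if t = i then x t else 0)"
    unfolding symf_def using True by (intro sum.cong refl) (auto simp: coord_vec_def unit_vec_def)
  then show ?thesis using True by (simp add: sum.delta)
next
  case False
  have "symf n x (coord_vec n i) = (\<Sum>t<n. if t = i - n then x (n + t) else 0)"
    unfolding symf_def using False assms
    by (intro sum.cong refl) (auto simp: coord_vec_def unit_vec_def)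
  also have "\<dots> = x (n + (i - n))" using False assms by (subst sum.delta) auto
  finally show ?thesis using False by simp
qed

lemma vcong_refl [simp]: "vcong q n x x"
  by (simp add: vcong_def)

lemma vcong_trans [trans]: "vcong q n x y \<Longrightarrow> vcong q n y z \<Longrightarrow> vcong q n x z"
  unfolding vcong_def by (meson cong_trans)

lemma dvd_symf_vcong:
  assumes "vcong q n u u'" "vcong q n v v'"
  shows "q dvd symf n u v \<longleftrightarrow> q dvd symf n u' v'"
  using symf_vcong[OF assms] by (rule cong_dvd_iff)

lemma prime_int_inverse:
  fixes q a :: int
  assumes "prime q" "\<not> q dvd a"
  obtains b where "[b * a = 1] (mod q)"
  using assms cong_solve_coprime_int[of a q]
  by (metis coprime_commute mult.commute prime_imp_coprime)

text \<open>The functional killing the first vectors but not the last one is a coordinate functional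
  corrected by the vectors found for the shorter family.\<close>

lemma symf_prescribed:
  assumes q: "prime q" and "lin_indep_mod q n r x"
  shows "\<exists>z. \<forall>j<r. [symf n (x j) z = b j] (mod q)"
  using assms(2)
proof (induction r arbitrary: b)
  case (Suc r)
  have "lin_indep_mod q n r x"
    unfolding lin_indep_mod_def
  proof (intro allI impI)
    fix c :: "nat \<Rightarrow> int" and j assume "\<forall>i<2*n. q dvd (\<Sum>j<r. c j * x j i)" "j < r"
    then show "q dvd c j"
      using Suc.prems[unfolded lin_indep_mod_def, rule_format, of "c(r := 0)" j] by simp
  qed
  note IH = Suc.IH[OF this]
  have "\<exists>z. \<forall>j<r. [symf n (x j) z = of_bool (j = l)] (mod q)" for l by (rule IH)
  then obtain z where z: "\<And>l j. j < r \<Longrightarrow> [symf n (x j) (z l) = of_bool (j = l)] (mod q)"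
    by metis
  \<comment> \<open>The coefficients of \<open>x r\<close> minus its components along the earlier
    vectors. As \<open>c r = 1\<close>, independence gives a coordinate \<open>i\<close> where this
    combination is nonzero modulo \<open>q\<close>, and that entry is exactly the product of
    \<open>x r\<close> with the \<open>w\<close> below.\<close>
  define c where "c l = (if l = r then 1 else - symf n (x r) (z l))" for l
  have "\<not> (\<forall>i<2*n. q dvd (\<Sum>j<Suc r. c j * x j i))"
  proof
    assume "\<forall>i<2*n. q dvd (\<Sum>j<Suc r. c j * x j i)"
    then have "q dvd c r" using Suc.prems[unfolded lin_indep_mod_def, rule_format, of c r] by simp
    then show False using q not_prime_unit[of q] by (auto simp: c_def)
  qed
  then obtain i where i: "i < 2*n" "\<not> q dvd (\<Sum>j<Suc r. c j * x j i)" by auto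
  define w where "w = (\<lambda>k. coord_vec n i k + (-1) * (\<Sum>l<r. x l i * z l k))"
  have w: "symf n u w = u i - (\<Sum>l<r. x l i * symf n u (z l))" for u
    unfolding w_def symf_add_right symf_sum_right symf_coord[OF i(1)] by simp
  have w0: "[symf n (x j) w = 0] (mod q)" if "j < r" for j
  proof -
    have "[symf n (x j) w = x j i - (\<Sum>l<r. x l i * of_bool (j = l))] (mod q)"
      unfolding w using z[OF that] by (intro cong_diff cong_sum cong_mult) auto
    moreover have "(\<Sum>l<r. x l i * of_bool (j = l)) = (\<Sum>l<r. if l = j then x l i else 0)"
      by (intro sum.cong) auto
    ultimately show ?thesis using that by simp
  qed
  have "symf n (x r) w = (\<Sum>j<Suc r. c j * x j i)"
    unfolding w by (simp add: c_def sum_negf mult.commute)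
  then obtain a where a: "[a * symf n (x r) w = 1] (mod q)"
    using prime_int_inverse[OF q] i(2) by metis
  obtain y where y: "\<And>j. j < r \<Longrightarrow> [symf n (x j) y = b j] (mod q)" using IH by blast
  define e where "e = (b r - symf n (x r) y) * a"
  have "[symf n (x j) (\<lambda>k. y k + e * w k) = b j] (mod q)" if "j < Suc r" for j
  proof (cases "j = r")
    case True
    have "[symf n (x r) y + (b r - symf n (x r) y) * (a * symf n (x r) w)
        = symf n (x r) y + (b r - symf n (x r) y) * 1] (mod q)"
      using a by (intro cong_add cong_mult) auto
    then show ?thesis using True unfolding symf_add_right by (simp add: e_def mult.assoc)
  next
    case False
    then have "[symf n (x j) y + e * symf n (x j) w = b j + e * 0] (mod q)"
      using that by (intro cong_add cong_mult y w0) auto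
    then show ?thesis unfolding symf_add_right by simp
  qed
  then show ?case by blast
qed simp

section \<open>The transvection group and its congruence subgroups\<close>

definition transvection :: "nat \<Rightarrow> int \<Rightarrow> (nat \<Rightarrow> int) \<Rightarrow> (nat \<Rightarrow> int) \<Rightarrow> nat \<Rightarrow> int" where
  "transvection n c u x = (\<lambda>i. x i + c * symf n x u * u i)"

text \<open>The parameter \<open>m\<close> plays the role of the level of a principal congruence
  subgroup; level 1 allows all integer multipliers.\<close>

inductive_set transvections :: "nat \<Rightarrow> int \<Rightarrow> ((nat \<Rightarrow> int) \<Rightarrow> nat \<Rightarrow> int) set"
  for n m where
  base: "(\<lambda>x. x) \<in> transvections n m"
| step: "G \<in> transvections n m \<Longrightarrow> (\<lambda>x. transvection n (m * c) u (G x)) \<in> transvections n m"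

lemma transvections_comp:
  assumes "H \<in> transvections n m" "G \<in> transvections n m"
  shows "(\<lambda>x. H (G x)) \<in> transvections n m"
  using assms by (induction rule: transvections.induct) (auto intro: transvections.step)

lemma transvections_mono: "G \<in> transvections n m \<Longrightarrow> G \<in> transvections n 1"
proof (induction rule: transvections.induct)
  case (step G c u)
  then show ?case using transvections.step[of G n 1 "m * c" u] by simp
qed (rule transvections.base)

text \<open>The two cross terms cancel by antisymmetry and \<open>u\<close> pairs to zero with
  itself. No modulus is involved, which is what makes the lifted frame exactly isotropic.\<close>

lemma transvection_symf: "symf n (transvection n c u x) (transvection n c u y) = symf n x y"
  unfolding transvection_def symf_add_left symf_add_right
  by (simp add: symf_swap[of n u] algebra_simps)

lemma transvections_symf: "G \<in> transvections n m \<Longrightarrow> symf n (G x) (G y) = symf n x y"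
  by (induction rule: transvections.induct) (simp_all add: transvection_symf)

text \<open>Negating the multiplier inverts a transvection, because adding multiples of
  \<open>u\<close> does not change the product with \<open>u\<close>. Any vector can thus be pulled
  back to standard coordinates.\<close>

lemma transvections_surj:
  "G \<in> transvections n m \<Longrightarrow> surj G"
proof (induction rule: transvections.induct)
  case (step G c u)
  have "surj (transvection n (m * c) u)"
  proof (rule surjI)
    show "transvection n (m * c) u (transvection n (- (m * c)) u x) = x" for x
      unfolding transvection_def symf_add_left by simp
  qed
  then show ?case using step.IH comp_surj[of G "transvection n (m * c) u"] by (simp add: comp_def)
qed (simp add: surj_def)

lemma transvections_add:
  "G \<in> transvections n m \<Longrightarrow> G (\<lambda>i. x i + c * y i) = (\<lambda>i. G x i + c * G y i)"
proof (induction rule: transvections.induct)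
  case (step G a u)
  then show ?case by (simp add: transvection_def symf_add_left algebra_simps)
qed simp

lemma transvections_sum:
  assumes "G \<in> transvections n m"
  shows "G (\<lambda>i. \<Sum>j<(r::nat). c j * x j i) = (\<lambda>i. \<Sum>j<r. c j * G (x j) i)"
proof (induction r)
  case 0
  have "G (\<lambda>i. 0) i = G (\<lambda>i. 0) i + G (\<lambda>i. 0) i" for i
    using fun_cong[OF transvections_add[OF assms, of "\<lambda>i. 0" 1 "\<lambda>i. 0"], of i] by simp
  then show ?case by (simp add: fun_eq_iff)
next
  case (Suc r)
  then show ?case
    using transvections_add[OF assms, of "\<lambda>i. \<Sum>j<r. c j * x j i" "c r" "x r"] by simp
qed

lemma transvections_vcong_self: "G \<in> transvections n m \<Longrightarrow> vcong m n (G x) x"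
proof (induction rule: transvections.induct)
  case (step G c u)
  have "vcong m n (transvection n (m * c) u (G x)) (G x)"
    by (simp add: vcong_def transvection_def cong_iff_dvd_diff)
  then show ?case using step.IH vcong_trans by blast
qed simp

lemma transvections_vcong: "G \<in> transvections n m \<Longrightarrow> vcong q n x y \<Longrightarrow> vcong q n (G x) (G y)"
proof (induction rule: transvections.induct)
  case (step G c u)
  then have *: "vcong q n (G x) (G y)" by blast
  show ?case unfolding vcong_def transvection_def
    using * symf_vcong[OF * vcong_refl] by (auto simp: vcong_def intro!: cong_add cong_mult)
qed

text \<open>Along \<open>u = y - x\<close> the product of \<open>x\<close> with \<open>u\<close>
  equals that with \<open>y\<close>, so the multiplier has to be its inverse modulo
  \<open>q\<close>; coprimality allows it to be a multiple of \<open>m\<close>. Vectors orthogonal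
  to both \<open>x\<close> and \<open>y\<close> are orthogonal to \<open>u\<close>, hence
  fixed.\<close>

lemma transvection_between:
  assumes q: "prime q" and m: "coprime m q" and xy: "\<not> q dvd symf n x y"
    and ys: "\<And>j. j < r \<Longrightarrow> q dvd symf n (w j) x" "\<And>j. j < r \<Longrightarrow> q dvd symf n (w j) y"
  obtains H where "H \<in> transvections n m" "vcong q n (H x) y" "\<And>j. j < r \<Longrightarrow> vcong q n (H (w j)) (w j)"
proof -
  have "\<not> q dvd m * symf n x y"
    using q m xy by (metis coprime_common_divisor dvd_refl not_prime_unit prime_dvd_mult_iff)
  then obtain c where c: "[c * (m * symf n x y) = 1] (mod q)" using prime_int_inverse[OF q] by metis
  define u where "u = (\<lambda>i. y i - x i)"
  define H where "H = transvection n (m * c) u"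
  have "H \<in> transvections n m"
    unfolding H_def using transvections.step[OF transvections.base] by fastforce
  moreover have "vcong q n (H x) y"
    unfolding vcong_def
  proof (intro allI impI)
    fix i
    have "H x i = x i + c * (m * symf n x y) * u i"
      by (simp add: H_def transvection_def u_def symf_diff_right)
    also have "[\<dots> = x i + 1 * u i] (mod q)" using c by (intro cong_add cong_mult) auto
    finally show "[H x i = y i] (mod q)" by (simp add: u_def)
  qed
  moreover have "vcong q n (H (w j)) (w j)" if "j < r" for j
    unfolding vcong_def H_def transvection_def u_def symf_diff_right
    using ys[OF that] by (simp add: cong_iff_dvd_diff)
  ultimately show ?thesis using that by blast
qed

text \<open>Witt's theorem for isotropic frames: a single transvection joins two vectors with nonzero
  product, and vectors with vanishing product are joined through a third one that pairs
  nontrivially with both.\<close>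

lemma transvections_transitive:
  assumes q: "prime q" and m: "coprime m q"
    and x: "lin_indep_mod q n r x" "isotropic_mod q n r x"
    and y: "lin_indep_mod q n r y" "isotropic_mod q n r y"
  shows "\<exists>G\<in>transvections n m. \<forall>j<r. vcong q n (G (x j)) (y j)"
proof -
  have "\<exists>G\<in>transvections n m. \<forall>j<l. vcong q n (G (x j)) (y j)" if "l \<le> r" for l
    using that
  proof (induction l)
    case 0
    then show ?case using transvections.base by blast
  next
    case (Suc l)
    then obtain G where G: "G \<in> transvections n m" "\<And>j. j < l \<Longrightarrow> vcong q n (G (x j)) (y j)" by auto
    \<comment> \<open>Modulo \<open>q\<close>, both \<open>x'\<close> and \<open>y l\<close> are
      orthogonal to the vectors already placed; one must be moved to the other while these stay
      fixed.\<close>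
    define x' where "x' = G (x l)"
    have yx': "q dvd symf n (y j) x'" if "j < l" for j
      using x(2) Suc.prems that dvd_symf_vcong[OF G(2)[OF that] vcong_refl, of x']
      by (simp add: x'_def transvections_symf[OF G(1)] isotropic_mod_def)
    have yy: "q dvd symf n (y j) (y l)" if "j < l" for j
      using y(2) Suc.prems that by (simp add: isotropic_mod_def)
    obtain z' where z': "\<And>j. j < r \<Longrightarrow> [symf n (x j) z' = of_bool (j = l)] (mod q)"
      using symf_prescribed[OF q x(1), of "\<lambda>j. of_bool (j = l)"] by blast
    define z1 where "z1 = G z'"
    have z1: "[symf n x' z1 = 1] (mod q)"
      using z'[of l] Suc.prems by (simp add: z1_def x'_def transvections_symf[OF G(1)])
    have z1y: "[symf n (y j) z1 = 0] (mod q)" if "j < l" for j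
    proof -
      have "[symf n (G (x j)) z1 = 0] (mod q)"
        using z'[of j] Suc.prems that by (simp add: z1_def transvections_symf[OF G(1)])
      then show ?thesis using symf_vcong[OF G(2)[OF that] vcong_refl, of z1] cong_sym cong_trans
        by blast
    qed
    obtain z2 where z2: "\<And>j. j < r \<Longrightarrow> [symf n (y j) z2 = of_bool (j = l)] (mod q)"
      using symf_prescribed[OF q y(1), of "\<lambda>j. of_bool (j = l)"] by blast
    have n1: "\<not> q dvd a" if "[a = 1] (mod q)" for a
      using that q cong_dvd_iff not_prime_unit by blast
    have d0: "q dvd a" if "[a = 0] (mod q)" for a
      using that by (simp add: cong_0_iff)
    have z2y: "\<forall>j<l. q dvd symf n (y j) z2"
    proof (intro allI impI d0)
      fix j assume "j < l"
      then show "[symf n (y j) z2 = 0] (mod q)" using z2[of j] Suc.prems by simp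
    qed
    have z2l: "\<not> q dvd symf n (y l) z2" using z2[of l] n1 Suc.prems by simp
    \<comment> \<open>\<open>z1\<close> pairs nontrivially with \<open>x'\<close> and
      \<open>z2\<close> with \<open>y l\<close>. If each of them fails on the other vector, their
      sum works for both.\<close>
    have "\<exists>z. \<not> q dvd symf n x' z \<and> \<not> q dvd symf n (y l) z \<and> (\<forall>j<l. q dvd symf n (y j) z)"
    proof -
      consider "\<not> q dvd symf n (y l) z1" | "\<not> q dvd symf n x' z2"
        | "q dvd symf n (y l) z1" "q dvd symf n x' z2" by blast
      then show ?thesis
      proof cases
        case 1
        then show ?thesis using z1 z1y n1 d0 by blast
      next
        case 2
        then show ?thesis using z2l z2y by blast
      next
        case 3
        let ?z = "\<lambda>i. z1 i + 1 * z2 i"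
        have "symf n u ?z = symf n u z1 + symf n u z2" for u
          unfolding symf_add_right by simp
        moreover have "\<not> q dvd symf n x' z1 + symf n x' z2"
          using n1[OF z1] 3(2) by (simp add: dvd_add_left_iff)
        moreover have "\<not> q dvd symf n (y l) z1 + symf n (y l) z2"
          using z2l 3(1) by (simp add: dvd_add_right_iff)
        moreover have "\<forall>j<l. q dvd symf n (y j) z1 + symf n (y j) z2"
          using d0[OF z1y] z2y by (blast intro: dvd_add)
        ultimately show ?thesis by (intro exI[of _ ?z]) simp
      qed
    qed
    then obtain z where z: "\<not> q dvd symf n x' z" "\<not> q dvd symf n z (y l)"
      "\<And>j. j < l \<Longrightarrow> q dvd symf n (y j) z"
      by (metis symf_swap dvd_minus_iff)
    obtain H1 where H1: "H1 \<in> transvections n m" "vcong q n (H1 x') z"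
      "\<And>j. j < l \<Longrightarrow> vcong q n (H1 (y j)) (y j)"
      using transvection_between[OF q m z(1), of l y] yx' z(3) by blast
    obtain H2 where H2: "H2 \<in> transvections n m" "vcong q n (H2 z) (y l)"
      "\<And>j. j < l \<Longrightarrow> vcong q n (H2 (y j)) (y j)"
      using transvection_between[OF q m z(2), of l y] yy z(3) by blast
    let ?G = "\<lambda>v. H2 (H1 (G v))"
    have "?G \<in> transvections n m"
      using transvections_comp[OF H2(1) transvections_comp[OF H1(1) G(1)]] .
    moreover have "vcong q n (?G (x j)) (y j)" if "j < Suc l" for j
    proof (cases "j = l")
      case True
      then show ?thesis using transvections_vcong[OF H2(1) H1(2)] H2(2) vcong_trans
        by (auto simp: x'_def)
    next
      case False
      then have "j < l" using that by simp
      have "vcong q n (?G (x j)) (H2 (H1 (y j)))"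
        using transvections_vcong[OF H2(1) transvections_vcong[OF H1(1) G(2)]] \<open>j < l\<close> .
      also have "vcong q n (H2 (H1 (y j))) (H2 (y j))"
        using transvections_vcong[OF H2(1) H1(3)] \<open>j < l\<close> .
      also have "vcong q n (H2 (y j)) (y j)" using H2(3) \<open>j < l\<close> .
      finally show ?thesis .
    qed
    ultimately show ?case by (intro bexI[of _ ?G]) auto
  qed
  then show ?thesis by blast
qed

section \<open>Reed-Solomon frames\<close>

text \<open>Up to sign this is an \<open>N\<close>-th finite difference. Writing \<open>f\<close> as
  \<open>c + t * g\<close>, the constant dies in the alternating row sum, and absorbing
  \<open>t\<close> into the binomial coefficient leaves the same sum for a shift of
  \<open>g\<close>, of smaller degree.\<close>

lemma alternating_binomial_poly_sum:
  fixes f :: "int poly"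
  assumes "degree f < N"
  shows "(\<Sum>t\<le>N. (-1) ^ t * int (N choose t) * poly f (int t)) = 0"
  using assms
proof (induction N arbitrary: f)
  case (Suc N)
  obtain c g where f: "f = pCons c g" by (cases f)
  have *: "(\<Sum>t\<le>Suc N. (-1) ^ t * int (Suc N choose t)) = 0"
    using choose_alternating_sum[of "Suc N", where ?'a = int] by simp
  have "(\<Sum>t\<le>Suc N. (-1) ^ t * int (Suc N choose t) * poly f (int t))
      = c * (\<Sum>t\<le>Suc N. (-1) ^ t * int (Suc N choose t))
        + (\<Sum>t\<le>Suc N. (-1) ^ t * (int t * int (Suc N choose t)) * poly g (int t))"
    by (simp add: f sum_distrib_left sum.distrib[symmetric] algebra_simps del: sum.atMost_Suc)
  also have "\<dots> = (\<Sum>t\<le>N. (-1) ^ Suc t * (int (Suc t) * int (Suc N choose Suc t)) * poly g (int (Suc t)))"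
    unfolding * by (subst sum.atMost_Suc_shift) simp
  also have "\<dots> = (\<Sum>t\<le>N. - int (Suc N) * ((-1) ^ t * int (N choose t) * poly (pcompose g [:1, 1:]) (int t)))"
  proof (rule sum.cong)
    fix t
    have "int (Suc t) * int (Suc N choose Suc t) = int (Suc N) * int (N choose t)"
      using Suc_times_binomial[of t N] by (metis of_nat_mult)
    moreover have "poly (pcompose g [:1, 1:]) (int t) = poly g (int (Suc t))"
      by (simp add: poly_pcompose)
    moreover have "(-1) ^ Suc t * a * b = - k * ((-1) ^ t * c * b)" if "a = k * c" for a b c k :: int
      using that by simp
    ultimately show "(-1) ^ Suc t * (int (Suc t) * int (Suc N choose Suc t)) * poly g (int (Suc t))
      = - int (Suc N) * ((-1) ^ t * int (N choose t) * poly (pcompose g [:1, 1:]) (int t))"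
      by (simp only:)
  qed simp
  also have "\<dots> = - int (Suc N) * (\<Sum>t\<le>N. (-1) ^ t * int (N choose t) * poly (pcompose g [:1, 1:]) (int t))"
    by (simp only: sum_distrib_left)
  also have "\<dots> = 0"
  \<comment> \<open>Constant \<open>f\<close> is treated apart: \<open>N\<close> may then be 0,
    where the strict degree bound of the induction hypothesis cannot hold.\<close>
  proof (cases "g = 0")
    case False
    then have "degree (pcompose g [:1, 1:]) < N" using Suc.prems by (simp add: f degree_pcompose)
    then show ?thesis using Suc.IH by simp
  qed simp
  finally show ?case .
qed simp

section \<open>Roots and power sums modulo a prime\<close>

lemma prime_dvd_diff_nat_less:
  fixes p :: int
  assumes "s < n" "t < n" "int n \<le> p" "p dvd int s - int t"
  shows "s = t"
  using assms zdvd_imp_le[of p "int s - int t"] zdvd_imp_le[of p "int t - int s"]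
  by (cases s t rule: linorder_cases) (auto simp: dvd_diff_commute)

text \<open>A polynomial with as many roots modulo \<open>p\<close> as coefficients vanishes modulo
  \<open>p\<close>. Synthetic division splits off the last root over the integers, and the quotient
  keeps the other roots since differences of distinct points are units modulo
  \<open>p\<close>.\<close>

lemma prime_dvd_coeff:
  fixes p :: int and h :: "int poly"
  assumes p: "prime p" "int n \<le> p"
    and "\<And>i. i \<ge> l \<Longrightarrow> coeff h i = 0" "l \<le> n"
    and "\<And>t. t < l \<Longrightarrow> p dvd poly h (int t)"
  shows "p dvd coeff h i"
  using assms(3-)
proof (induction l arbitrary: h i)
  case (Suc l)
  let ?g = "synthetic_div h (int l)"
  have h: "h = [:- int l, 1:] * ?g + [:poly h (int l):]"
    using synthetic_div_correct'[of "int l" h] by simp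
  have "p dvd coeff ?g j" for j
  proof (rule Suc.IH)
    fix i assume "l \<le> i"
    show "coeff ?g i = 0"
    \<comment> \<open>For constant \<open>h\<close> the bound \<open>degree ?g < i\<close> can fail
      at \<open>i = 0\<close>, but then the quotient is zero.\<close>
    proof (cases "degree h = 0")
      case True
      then show ?thesis using synthetic_div_eq_0_iff[of h "int l"] by simp
    next
      case False
      then have "degree h \<le> l" using Suc.prems(1) by (metis degree_le not_less_eq_eq not_less le_degree leading_coeff_0_iff degree_0)
      then have "degree ?g < i" using \<open>l \<le> i\<close> False by (simp add: degree_synthetic_div)
      then show ?thesis by (rule coeff_eq_0)
    qed
  next
    show "l \<le> n" using Suc.prems by simp
  next
    fix t assume t: "t < l"
    have "poly h (int t) - poly h (int l) = (int t - int l) * poly ?g (int t)"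
      by (subst (1) h) (simp add: algebra_simps)
    moreover have "p dvd poly h (int t) - poly h (int l)" using Suc.prems(3) t by (simp add: dvd_diff)
    ultimately have "p dvd (int t - int l) * poly ?g (int t)" by simp
    moreover have "\<not> p dvd int t - int l"
      using prime_dvd_diff_nat_less[of t n l p] t Suc.prems(2) p(2) by auto
    ultimately show "p dvd poly ?g (int t)" using p(1) prime_dvd_mult_iff by blast
  qed
  then have "p dvd coeff ([:- int l, 1:] * ?g) i"
    by (simp add: coeff_pCons split: nat.split)
  moreover have "p dvd coeff [:poly h (int l):] i"
    using Suc.prems(3) by (auto simp: coeff_pCons split: nat.split)
  ultimately have "p dvd coeff ([:- int l, 1:] * ?g + [:poly h (int l):]) i"
    unfolding coeff_add by (rule dvd_add)
  then show ?case using h by metis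
qed simp

lemma power_rows_indep:
  fixes p :: int
  assumes p: "prime p" "int n \<le> p" and "s \<le> n"
    and *: "\<And>t. t < n \<Longrightarrow> p dvd (\<Sum>i<s. c i * int t ^ i)" and "i < s"
  shows "p dvd c i"
proof -
  define h where "h = (\<Sum>i<s. monom (c i) i)"
  have coeff: "coeff h j = (if j < s then c j else 0)" for j
    by (simp add: h_def coeff_sum sum.delta)
  have "p dvd coeff h i"
    using p(1,2) assms(3) *
    by (intro prime_dvd_coeff[of p n s]) (simp_all add: coeff, simp add: h_def poly_sum poly_monom)
  then show ?thesis using assms by (simp add: coeff)
qed

text \<open>Any \<open>s\<close> columns of the Vandermonde matrix are independent: testing the sums
  against the Lagrange polynomial that vanishes on \<open>T\<close> except at \<open>t\<close>
  isolates \<open>a t\<close> times a unit modulo \<open>p\<close>.\<close>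

lemma power_sums_dvd_imp_dvd:
  fixes p :: int
  assumes p: "prime p" "int n \<le> p" and T: "T \<subseteq> {..<n}" "card T \<le> s"
    and *: "\<And>j. j < s \<Longrightarrow> p dvd (\<Sum>t\<in>T. a t * int t ^ j)" and "t \<in> T"
  shows "p dvd a t"
proof -
  have fin: "finite T" using T(1) finite_subset by blast
  define f where "f = (\<Prod>u\<in>T - {t}. [:- int u, 1:])"
  have deg: "degree f < s"
  proof -
    have "degree f \<le> (\<Sum>u\<in>T - {t}. degree [:- int u, 1:])"
      unfolding f_def using degree_prod_sum_le[of "T - {t}" "\<lambda>u. [:- int u, 1:]"] fin
      by (simp add: comp_def)
    also have "\<dots> < s" using fin T(2) \<open>t \<in> T\<close> by (auto simp: card_gt_0_iff
          intro: less_le_trans[OF diff_less])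
    finally show ?thesis .
  qed
  have "(\<Sum>u\<in>T. a u * poly f (int u)) = (\<Sum>u\<in>T. \<Sum>j\<le>degree f. coeff f j * (a u * int u ^ j))"
    by (simp add: poly_altdef sum_distrib_left algebra_simps)
  also have "\<dots> = (\<Sum>j\<le>degree f. coeff f j * (\<Sum>u\<in>T. a u * int u ^ j))"
    by (subst sum.swap) (simp add: sum_distrib_left)
  also have "p dvd \<dots>" by (rule dvd_sum, rule dvd_mult, rule *) (use deg in auto)
  finally have "p dvd (\<Sum>u\<in>T. a u * poly f (int u))" .
  moreover have "(\<Sum>u\<in>T. a u * poly f (int u)) = (\<Sum>u\<in>T. if u = t then a t * poly f (int t) else 0)"
    using fin by (intro sum.cong) (auto simp: f_def poly_prod)
  ultimately have "p dvd a t * poly f (int t)" using fin \<open>t \<in> T\<close> by (simp add: sum.delta)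
  moreover have "\<not> p dvd poly f (int t)"
  proof
    assume "p dvd poly f (int t)"
    then have "p dvd (\<Prod>u\<in>T - {t}. int t - int u)"
      by (simp add: f_def poly_prod)
    then obtain u where u: "u \<in> T - {t}" "p dvd int t - int u"
      using prime_dvd_prod_iff[of "T - {t}" p] fin p(1) by auto
    then show False using prime_dvd_diff_nat_less[of t n u p] T \<open>t \<in> T\<close> p(2) by auto
  qed
  ultimately show ?thesis using p(1) prime_dvd_mult_iff by blast
qed

lemma prime_not_dvd_binomial:
  fixes p :: int
  assumes "prime p" "int N < p" "t \<le> N"
  shows "\<not> p dvd int (N choose t)"
proof
  assume "p dvd int (N choose t)"
  moreover have "int (fact t * fact (N - t) * (N choose t)) = int (fact N)"
    using binomial_fact_lemma[OF assms(3)] by simp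
  ultimately have "p dvd int (fact N)" by (metis dvd_mult of_nat_mult)
  moreover obtain p' where p': "p = int p'" using assms(2) by (metis nonneg_int_cases of_nat_0_le_iff le_less_trans less_imp_le)
  ultimately have "p' dvd fact N" by (metis int_dvd_int_iff)
  then show False using p' assms(1,2) prime_dvd_fact_iff[of p' N] by simp
qed

section \<open>The Reed-Solomon frame: commutation, independence, distance\<close>

lemma sum_lessThan_add: "(\<Sum>j<a + b. f j) = (\<Sum>j<a. f j) + (\<Sum>j<b. f (a + j))"
  for f :: "nat \<Rightarrow> int"
  by (induction b) (simp_all add: add.assoc)

text \<open>Up to a global sign this is (n - 1)! divided by the product of the differences
  \<open>t - u\<close> over the other points \<open>u\<close> below \<open>n\<close>: the dual
  multipliers of Reed-Solomon codes, scaled to be integers.\<close>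

definition rs_weight :: "nat \<Rightarrow> nat \<Rightarrow> int" where
  "rs_weight n t = (-1) ^ t * int ((n - 1) choose t)"

text \<open>X-type and Z-type rows commute because the \<open>(n - 1)\<close>-st finite difference kills polynomials of
  smaller degree.\<close>

definition rs_frame :: "nat \<Rightarrow> nat \<Rightarrow> nat \<Rightarrow> nat \<Rightarrow> int" where
  "rs_frame n s j = (if j < s then (\<lambda>i. if i < n then int i ^ j else 0)
     else (\<lambda>i. if i < n then 0 else rs_weight n (i - n) * int (i - n) ^ (j - s)))"

lemma rs_weight_power_sum:
  assumes "e < n - 1"
  shows "(\<Sum>t<n. rs_weight n t * int t ^ e) = 0"
proof -
  have "degree (monom 1 e :: int poly) < n - 1" using assms by (simp add: degree_monom_eq)
  moreover have "{..<n} = {..n - 1}" using assms by auto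
  ultimately show ?thesis
    using alternating_binomial_poly_sum[of "monom 1 e" "n - 1"]
    unfolding rs_weight_def poly_monom mult_1 by metis
qed

lemma rs_weight_not_dvd:
  assumes "prime p" "int n \<le> p" "t < n"
  shows "\<not> p dvd rs_weight n t"
proof -
  have "\<not> p dvd int ((n - 1) choose t)" using assms by (intro prime_not_dvd_binomial) auto
  moreover have "\<not> p dvd (-1) ^ t"
    using assms(1) not_prime_unit[of p] by (auto simp: minus_one_power_iff split: if_splits)
  ultimately show ?thesis using assms(1) by (simp add: rs_weight_def prime_dvd_mult_iff)
qed

lemma symf_rs_frame_X:
  "j < s \<Longrightarrow> symf n v (rs_frame n s j) = - (\<Sum>t<n. v (n + t) * int t ^ j)"
  by (simp add: symf_def rs_frame_def sum_negf mult.commute)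

lemma symf_rs_frame_Z:
  "s \<le> j \<Longrightarrow> symf n v (rs_frame n s j) = (\<Sum>t<n. v t * rs_weight n t * int t ^ (j - s))"
  by (simp add: symf_def rs_frame_def mult.assoc)

lemma symf_rs_frame:
  assumes "r < n" "s \<le> r" "i < r" "j < r"
  shows "symf n (rs_frame n s i) (rs_frame n s j) = 0"
proof -
  have XZ: "symf n (rs_frame n s i) (rs_frame n s j) = 0" if "i < s" "s \<le> j" "j < r" for i j
  proof -
    have "symf n (rs_frame n s i) (rs_frame n s j) = (\<Sum>t<n. rs_weight n t * int t ^ (i + (j - s)))"
      using that unfolding power_add
      by (subst symf_rs_frame_Z) (auto simp: rs_frame_def intro!: sum.cong)
    \<comment> \<open>The exponent is at most (s - 1) + (r - 1 - s) = r - 2, below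
      \<open>n - 1\<close> because \<open>r < n\<close>.\<close>
    also have "\<dots> = 0" using that assms by (intro rs_weight_power_sum) auto
    finally show ?thesis .
  qed
  consider "i < s" "j < s" | "i < s" "s \<le> j" | "s \<le> i" "j < s" | "s \<le> i" "s \<le> j" by linarith
  then show ?thesis
  proof cases
    case 1
    then show ?thesis by (simp add: symf_rs_frame_X) (simp add: rs_frame_def)
  next
    case 2
    then show ?thesis using XZ assms by blast
  next
    case 3
    then show ?thesis using XZ[of j i] assms symf_swap[of n "rs_frame n s i"] by simp
  next
    case 4
    then show ?thesis by (simp add: symf_rs_frame_Z) (simp add: rs_frame_def)
  qed
qed

text \<open>X rows and Z rows occupy different halves of the coordinates, so a relation splits into
  two Vandermonde relations; the weights in the second are units modulo \<open>p\<close>.\<close>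

lemma rs_frame_indep:
  assumes p: "prime p" "int n \<le> p" and "r \<le> n" "s \<le> r"
  shows "lin_indep_mod p n r (rs_frame n s)"
  unfolding lin_indep_mod_def
proof (intro allI impI)
  fix c :: "nat \<Rightarrow> int" and j
  assume *: "\<forall>i<2*n. p dvd (\<Sum>j<r. c j * rs_frame n s j i)" and "j < r"
  have split: "(\<Sum>j<r. f j) = (\<Sum>j<s. f j) + (\<Sum>j<r - s. f (s + j))" for f :: "nat \<Rightarrow> int"
    using sum_lessThan_add[of f s "r - s"] assms(4) by simp
  show "p dvd c j"
  proof (cases "j < s")
    case True
    show ?thesis
    proof (rule power_rows_indep[where c = c and s = s, OF p])
      fix t assume t: "t < n"
      then have "p dvd (\<Sum>j<r. c j * rs_frame n s j t)" using *[rule_format, of t] by simp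
      then show "p dvd (\<Sum>i<s. c i * int t ^ i)"
        using t unfolding split by (simp add: rs_frame_def)
    next
      show "s \<le> n" using assms by simp
    qed (rule True)
  next
    case False
    have "p dvd c (s + (j - s))"
    proof (rule power_rows_indep[where c = "\<lambda>j. c (s + j)" and s = "r - s", OF p])
      fix t assume t: "t < n"
      then have "p dvd (\<Sum>j<r. c j * rs_frame n s j (n + t))" using *[rule_format, of "n + t"] by simp
      then have "p dvd (\<Sum>i<r - s. rs_weight n t * (c (s + i) * int t ^ i))"
        using t unfolding split by (simp add: rs_frame_def algebra_simps)
      then have "p dvd rs_weight n t * (\<Sum>i<r - s. c (s + i) * int t ^ i)"
        by (simp add: sum_distrib_left)
      then show "p dvd (\<Sum>i<r - s. c (s + i) * int t ^ i)"
        using rs_weight_not_dvd[OF p t] p(1) prime_dvd_mult_iff by blast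
    next
      show "r - s \<le> n" using assms by simp
      show "j - s < r - s" using False \<open>j < r\<close> by simp
    qed
    then show ?thesis using False by simp
  qed
qed

text \<open>X rows test the Z half of \<open>v\<close> and Z rows its weighted X half. The split at
  \<open>r div 2\<close> gives each half at least \<open>r div 2\<close> vanishing power sums,
  enough for a support of that size. The support is that over the integers, which stays the same
  when \<open>p\<close> is divided out later.\<close>

lemma rs_frame_perp_weight:
  assumes p: "prime p" "int n \<le> p"
    and v: "\<And>j. j < r \<Longrightarrow> p dvd symf n v (rs_frame n (r div 2) j)"
    and few: "card {t. t < n \<and> (v t \<noteq> 0 \<or> v (n + t) \<noteq> 0)} \<le> r div 2"
    and "i < 2*n"
  shows "p dvd v i"
proof -
  define T where "T = {t. t < n \<and> (v t \<noteq> 0 \<or> v (n + t) \<noteq> 0)}"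
  have T: "T \<subseteq> {..<n}" "card T \<le> r div 2" using few by (auto simp: T_def)
  have restrict: "(\<Sum>t<n. f t) = (\<Sum>t\<in>T. f t)"
    if "\<And>t. t < n \<Longrightarrow> t \<notin> T \<Longrightarrow> f t = 0" for f :: "nat \<Rightarrow> int"
    using T(1) that by (intro sum.mono_neutral_right) auto
  have Z: "p dvd v (n + t)" if "t \<in> T" for t
  proof (rule power_sums_dvd_imp_dvd[OF p T _ that, of "\<lambda>t. v (n + t)"])
    fix j assume j: "j < r div 2"
    have "(\<Sum>t<n. v (n + t) * int t ^ j) = (\<Sum>t\<in>T. v (n + t) * int t ^ j)"
      by (rule restrict) (simp add: T_def)
    moreover have "p dvd (\<Sum>t<n. v (n + t) * int t ^ j)"
      using v[of j] j by (simp add: symf_rs_frame_X)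
    ultimately show "p dvd (\<Sum>t\<in>T. v (n + t) * int t ^ j)" by simp
  qed
  have X: "p dvd v t" if "t \<in> T" for t
  proof -
    have "p dvd v t * rs_weight n t"
    proof (rule power_sums_dvd_imp_dvd[OF p T _ that, of "\<lambda>t. v t * rs_weight n t"])
      fix j assume j: "j < r div 2"
      have "(\<Sum>t<n. v t * rs_weight n t * int t ^ j) = (\<Sum>t\<in>T. v t * rs_weight n t * int t ^ j)"
        by (rule restrict) (simp add: T_def)
      moreover have "p dvd (\<Sum>t<n. v t * rs_weight n t * int t ^ j)"
        using v[of "r div 2 + j"] j by (simp add: symf_rs_frame_Z)
      ultimately show "p dvd (\<Sum>t\<in>T. v t * rs_weight n t * int t ^ j)" by simp
    qed
    then show ?thesis using rs_weight_not_dvd[OF p, of t] p(1) that T(1) prime_dvd_mult_iff by blast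
  qed
  show ?thesis
  proof (cases "i < n")
    case True
    then show ?thesis using X[of i] by (cases "i \<in> T") (auto simp: T_def)
  next
    case False
    then show ?thesis using Z[of "i - n"] \<open>i < 2*n\<close> by (cases "i - n \<in> T") (auto simp: T_def)
  qed
qed

section \<open>Quantum Singleton bound\<close>

text \<open>Subspaces over the field with \<open>q\<close> elements, on reduced representatives, so
  that cardinality can stand in for dimension.\<close>

definition mod_space :: "int \<Rightarrow> (nat \<Rightarrow> int) set \<Rightarrow> bool" where
  "mod_space q A \<longleftrightarrow> finite A \<and> (\<forall>x\<in>A. \<forall>i. 0 \<le> x i \<and> x i < q)
     \<and> (\<forall>x\<in>A. \<forall>y\<in>A. \<forall>c. (\<lambda>i. (x i + c * y i) mod q) \<in> A)"

text \<open>Each element of \<open>A\<close> is uniquely a kernel element plus a multiple of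
  \<open>x0\<close>; the multiple is \<open>f x\<close> divided by \<open>f x0\<close> modulo
  \<open>q\<close>.\<close>

lemma card_kernel:
  assumes q: "prime q" and A: "mod_space q A"
    and f: "\<And>x y c. [f (\<lambda>i. (x i + c * y i) mod q) = f x + c * f y] (mod q)"
    and x0: "x0 \<in> A" "\<not> q dvd f x0"
  shows "card A = nat q * card {x \<in> A. q dvd f x}"
proof -
  have q0: "q > 0" using q by (simp add: prime_gt_0_int)
  obtain b where b: "[b * f x0 = 1] (mod q)" using prime_int_inverse[OF q x0(2)] .
  let ?h = "\<lambda>(x, c). (\<lambda>i. (x i + c * x0 i) mod q)"
  let ?K = "{x \<in> A. q dvd f x}"
  have "bij_betw ?h (?K \<times> {0..<q}) A"
    unfolding bij_betw_def
  proof
    show "inj_on ?h (?K \<times> {0..<q})"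
    proof (rule inj_onI, clarify)
      fix x c y d assume x: "x \<in> A" "q dvd f x" and y: "y \<in> A" "q dvd f y"
        and c: "c \<in> {0..<q}" and d: "d \<in> {0..<q}"
        and eq: "(\<lambda>i. (x i + c * x0 i) mod q) = (\<lambda>i. (y i + d * x0 i) mod q)"
      have "[f x + c * f x0 = f y + d * f x0] (mod q)"
        using cong_trans[OF cong_sym[OF f[of x c x0], unfolded eq] f[of y d x0]] .
      moreover have "[f x = 0] (mod q)" "[f y = 0] (mod q)" using x y by (simp_all add: cong_0_iff)
      ultimately have "q dvd (f x + c * f x0) - (f y + d * f x0)" by (simp add: cong_iff_dvd_diff)
      moreover have "q dvd f x - f y" using x y by simp
      ultimately have "q dvd ((f x + c * f x0) - (f y + d * f x0)) - (f x - f y)" by (rule dvd_diff)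
      then have "q dvd (c - d) * f x0" by (simp add: algebra_simps)
      then have "q dvd c - d" using x0(2) q prime_dvd_mult_iff by blast
      then have cd: "c = d" using c d by (intro cong_less_imp_eq_int[of c q d]) (auto simp: cong_iff_dvd_diff)
      have "x i = y i" for i
      proof -
        have "[x i + c * x0 i = y i + c * x0 i] (mod q)"
          using fun_cong[OF eq, of i] cd by (simp add: cong_def)
        then have "[x i = y i] (mod q)" by (simp add: cong_add_rcancel)
        moreover have "0 \<le> x i" "x i < q" "0 \<le> y i" "y i < q"
          using A x(1) y(1) by (auto simp: mod_space_def)
        ultimately show ?thesis by (intro cong_less_imp_eq_int)
      qed
      then show "x = y \<and> c = d" using cd by auto
    qed
    show "?h ` (?K \<times> {0..<q}) = A"
    proof (intro equalityI subsetI)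
      fix x assume "x \<in> ?h ` (?K \<times> {0..<q})"
      then obtain k c where "k \<in> A" "x = (\<lambda>i. (k i + c * x0 i) mod q)" by auto
      then show "x \<in> A" using A x0(1) unfolding mod_space_def by blast
    next
      fix x assume x: "x \<in> A"
      define c where "c = (f x * b) mod q"
      define y where "y = (\<lambda>i. (x i + (- c) * x0 i) mod q)"
      have "[f y = f x + (- c) * f x0] (mod q)" unfolding y_def by (rule f)
      also have "[f x + (- c) * f x0 = f x + (- (f x * b)) * f x0] (mod q)"
        unfolding c_def by (intro cong_add cong_mult) (auto simp: cong_minus_minus_iff)
      also have "f x + (- (f x * b)) * f x0 = f x + (- f x) * (b * f x0)" by simp
      also have "[\<dots> = f x + (- f x) * 1] (mod q)" using b by (intro cong_add cong_mult) auto
      finally have "q dvd f y" by (simp add: cong_0_iff)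
      moreover have "y \<in> A" using A x x0(1) unfolding y_def mod_space_def by blast
      moreover have "c \<in> {0..<q}" using q0 by (simp add: c_def)
      moreover have "?h (y, c) = x"
      proof
        fix i
        have "[y i + c * x0 i = (x i + (- c) * x0 i) + c * x0 i] (mod q)"
          unfolding y_def by (intro cong_add) auto
        then have "(y i + c * x0 i) mod q = x i mod q" by (simp add: cong_def)
        also have "\<dots> = x i" using A x by (simp add: mod_space_def)
        finally show "?h (y, c) i = x i" by simp
      qed
      ultimately show "x \<in> ?h ` (?K \<times> {0..<q})" using x
        by (intro image_eqI[of _ _ "(y, c)"]) auto
    qed
  qed
  then have "card A = card (?K \<times> {0..<q})" by (simp add: bij_betw_same_card)
  then show ?thesis by (simp add: card_cartesian_product mult.commute)
qed

text \<open>For fixed \<open>x\<close> the functional on \<open>B\<close> vanishes or has a kernel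
  of index \<open>q\<close>. The factor \<open>nat q\<close> on the left expresses both cases
  without division.\<close>

lemma card_zero_pairs:
  assumes q: "prime q" and A: "mod_space q A" and B: "mod_space q B"
    and f: "\<And>x y z c. [f z (\<lambda>i. (x i + c * y i) mod q) = f z x + c * f z y] (mod q)"
  shows "nat q * (\<Sum>x\<in>A. card {y \<in> B. q dvd f x y})
    = card A * card B + (nat q - 1) * (card {x \<in> A. \<forall>y\<in>B. q dvd f x y} * card B)"
proof -
  have fin: "finite A" using A by (simp add: mod_space_def)
  have q1: "nat q = Suc (nat q - 1)" using prime_gt_0_int[OF q] by simp
  have "nat q * card {y \<in> B. q dvd f x y}
      = card B + (if \<forall>y\<in>B. q dvd f x y then (nat q - 1) * card B else 0)" for x
  proof (cases "\<forall>y\<in>B. q dvd f x y")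
    case True
    then have "{y \<in> B. q dvd f x y} = B" by auto
    then show ?thesis using True by (subst q1) simp
  next
    case False
    then obtain x0 where "x0 \<in> B" "\<not> q dvd f x x0" by auto
    then have "card B = nat q * card {y \<in> B. q dvd f x y}"
      using card_kernel[OF q B, where f = "f x", OF f] by blast
    then show ?thesis using False by (simp only: if_False)
  qed
  then have "nat q * (\<Sum>x\<in>A. card {y \<in> B. q dvd f x y})
     = card A * card B + (\<Sum>x\<in>A. if \<forall>y\<in>B. q dvd f x y then (nat q - 1) * card B else 0)"
    by (simp add: sum_distrib_left sum.distrib)
  also have "(\<Sum>x\<in>A. if \<forall>y\<in>B. q dvd f x y then (nat q - 1) * card B else 0)
     = (nat q - 1) * (card {x \<in> A. \<forall>y\<in>B. q dvd f x y} * card B)"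
    using fin by (simp add: sum.If_cases Int_def)
  finally show ?thesis .
qed

text \<open>Both sides count the pairs with vanishing pairing.\<close>

lemma card_radicals:
  assumes q: "prime q" and A: "mod_space q A" and B: "mod_space q B"
    and f: "\<And>x y z c. [f z (\<lambda>i. (x i + c * y i) mod q) = f z x + c * f z y] (mod q)"
    and g: "\<And>x y z c. [f (\<lambda>i. (x i + c * y i) mod q) z = f x z + c * f y z] (mod q)"
  shows "card {x \<in> A. \<forall>y\<in>B. q dvd f x y} * card B = card {y \<in> B. \<forall>x\<in>A. q dvd f x y} * card A"
proof -
  have fin: "finite A" "finite B" using A B by (simp_all add: mod_space_def)
  have "(\<Sum>x\<in>A. card {y \<in> B. q dvd f x y}) = (\<Sum>y\<in>B. card {x \<in> A. q dvd f x y})"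
    using fin by (rule sum_multicount_gen) auto
  then have "card A * card B + (nat q - 1) * (card {x \<in> A. \<forall>y\<in>B. q dvd f x y} * card B)
    = card B * card A + (nat q - 1) * (card {y \<in> B. \<forall>x\<in>A. q dvd f x y} * card A)"
    using card_zero_pairs[OF q A B, of f, OF f] card_zero_pairs[OF q B A, of "\<lambda>y x. f x y", OF g]
    by metis
  then have "(nat q - 1) * (card {x \<in> A. \<forall>y\<in>B. q dvd f x y} * card B)
    = (nat q - 1) * (card {y \<in> B. \<forall>x\<in>A. q dvd f x y} * card A)"
    unfolding mult.commute[of "card A" "card B"] by (rule add_left_imp_eq)
  moreover have "nat q - 1 \<noteq> 0" using prime_gt_1_int[OF q] by simp
  ultimately show ?thesis by (rule mult_left_cancel[THEN iffD1, rotated])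
qed

section \<open>Coordinate subspaces and spans as finite sets\<close>

definition mod_box :: "int \<Rightarrow> nat set \<Rightarrow> (nat \<Rightarrow> int) set" where
  "mod_box q I = {v. \<forall>i. if i \<in> I then 0 \<le> v i \<and> v i < q else v i = 0}"

lemma bij_mod_box:
  "bij_betw (\<lambda>f i. if i \<in> I then f i else 0) (I \<rightarrow>\<^sub>E {0..<q}) (mod_box q I)"
proof (rule bij_betwI[where g = "\<lambda>v. restrict v I"])
  show "(\<lambda>f i. if i \<in> I then f i else 0) \<in> (I \<rightarrow>\<^sub>E {0..<q}) \<rightarrow> mod_box q I"
    by (auto simp: mod_box_def dest!: PiE_mem)
  show "(\<lambda>v. restrict v I) \<in> mod_box q I \<rightarrow> I \<rightarrow>\<^sub>E {0..<q}"
    by (auto simp: mod_box_def)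
  show "restrict (\<lambda>i. if i \<in> I then f i else 0) I = f" if "f \<in> I \<rightarrow>\<^sub>E {0..<q}" for f
    using that by (auto simp: fun_eq_iff restrict_def PiE_def extensional_def)
  show "(\<lambda>i. if i \<in> I then restrict v I i else 0) = v" if "v \<in> mod_box q I" for v
    using that by (auto simp: mod_box_def fun_eq_iff)
qed

lemma finite_mod_box: "finite I \<Longrightarrow> finite (mod_box q I)"
  using bij_betw_finite[OF bij_mod_box[of I q]] by (simp add: finite_PiE)

lemma card_mod_box: "finite I \<Longrightarrow> card (mod_box q I) = nat q ^ card I"
  using bij_betw_same_card[OF bij_mod_box[of I q]] by (simp add: card_PiE)

lemma mod_space_mod_box:
  assumes "finite I" "q > 0"
  shows "mod_space q (mod_box q I)"
proof -
  have "0 \<le> x i \<and> x i < q" if "x \<in> mod_box q I" for x i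
    using that assms(2) by (cases "i \<in> I") (auto simp: mod_box_def dest: spec[of _ i])
  moreover have "(\<lambda>i. (x i + c * y i) mod q) \<in> mod_box q I"
    if "x \<in> mod_box q I" "y \<in> mod_box q I" for x y c
    using that assms(2) by (simp add: mod_box_def)
  ultimately show ?thesis unfolding mod_space_def using finite_mod_box[OF assms(1)] by blast
qed

text \<open>Entries are reduced, and zero from \<open>2*n\<close> on, so that spans and boxes can be
  intersected as sets of functions.\<close>

definition mod_span :: "int \<Rightarrow> nat \<Rightarrow> nat \<Rightarrow> (nat \<Rightarrow> nat \<Rightarrow> int) \<Rightarrow> (nat \<Rightarrow> int) set" where
  "mod_span q n r g = range (\<lambda>c i. if i < 2*n then (\<Sum>j<r. c j * g j i) mod q else 0)"

text \<open>Reducing the coefficients makes the span finite, with at most \<open>q ^ r\<close>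
  elements even if \<open>g\<close> is dependent.\<close>

lemma mod_span_eq_image:
  assumes "q > 0"
  shows "mod_span q n r g = (\<lambda>c i. if i < 2*n then (\<Sum>j<r. c j * g j i) mod q else 0) ` mod_box q {..<r}"
proof -
  have "\<exists>d\<in>mod_box q {..<r}. (\<lambda>i. if i < 2*n then (\<Sum>j<r. c j * g j i) mod q else 0)
     = (\<lambda>i. if i < 2*n then (\<Sum>j<r. d j * g j i) mod q else 0)" for c
  proof (rule bexI[of _ "\<lambda>j. if j < r then c j mod q else 0"])
    have "(\<Sum>j<r. c j * g j i) mod q = (\<Sum>j<r. (if j < r then c j mod q else 0) * g j i) mod q" for i
      unfolding cong_def[symmetric] by (intro cong_sum cong_mult) auto
    then show "(\<lambda>i. if i < 2*n then (\<Sum>j<r. c j * g j i) mod q else 0)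
      = (\<lambda>i. if i < 2*n then (\<Sum>j<r. (if j < r then c j mod q else 0) * g j i) mod q else 0)"
      by auto
  qed (use assms in \<open>auto simp: mod_box_def\<close>)
  then show ?thesis unfolding mod_span_def by blast
qed

lemma card_mod_span_le:
  assumes "q > 0"
  shows "card (mod_span q n r g) \<le> nat q ^ r"
proof -
  have "card (mod_span q n r g) \<le> card (mod_box q {..<r})"
    unfolding mod_span_eq_image[OF assms] by (intro card_image_le finite_mod_box) simp
  then show ?thesis by (simp add: card_mod_box)
qed

lemma mod_space_mod_span:
  assumes "q > 0"
  shows "mod_space q (mod_span q n r g)"
proof -
  have "(\<lambda>i. (x i + a * y i) mod q) \<in> mod_span q n r g"
    if xy: "x \<in> mod_span q n r g" "y \<in> mod_span q n r g" for x y a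
  proof -
    obtain c d where c: "x = (\<lambda>i. if i < 2*n then (\<Sum>j<r. c j * g j i) mod q else 0)"
      and d: "y = (\<lambda>i. if i < 2*n then (\<Sum>j<r. d j * g j i) mod q else 0)"
      using xy unfolding mod_span_def by auto
    have "(x i + a * y i) mod q = (\<Sum>j<r. (c j + a * d j) * g j i) mod q" if "i < 2*n" for i
    proof -
      have "(\<Sum>j<r. (c j + a * d j) * g j i) = (\<Sum>j<r. c j * g j i) + a * (\<Sum>j<r. d j * g j i)"
        by (simp add: sum.distrib sum_distrib_left algebra_simps)
      moreover have "[s mod q + a * (t mod q) = s + a * t] (mod q)" for s t :: int
        by (intro cong_add cong_mult) auto
      ultimately show ?thesis using that by (simp add: c d cong_def)
    qed
    then have "(\<lambda>i. (x i + a * y i) mod q)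
       = (\<lambda>i. if i < 2*n then (\<Sum>j<r. (c j + a * d j) * g j i) mod q else 0)"
      by (auto simp: c d)
    then show ?thesis unfolding mod_span_def by (rule range_eqI[where x = "\<lambda>j. c j + a * d j"])
  qed
  moreover have "finite (mod_span q n r g)"
    unfolding mod_span_eq_image[OF assms] by (simp add: finite_mod_box)
  ultimately show ?thesis using assms by (auto simp: mod_space_def mod_span_def)
qed

text \<open>Weight counts qudits but boxes count entries; each qudit owns an X and a Z entry,
  \<open>n\<close> apart.\<close>

definition coords_on :: "nat \<Rightarrow> nat set \<Rightarrow> nat set" where
  "coords_on n T = T \<union> (+) n ` T"

lemma card_coords_on:
  assumes "T \<subseteq> {..<n}"
  shows "card (coords_on n T) = 2 * card T" "finite (coords_on n T)"
proof -
  have fin: "finite T" using assms finite_subset by blast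
  have "card (T \<union> (+) n ` T) = card T + card ((+) n ` T)"
    using assms fin by (intro card_Un_disjoint) auto
  then show "card (coords_on n T) = 2 * card T" by (simp add: coords_on_def card_image)
  show "finite (coords_on n T)" using fin by (simp add: coords_on_def)
qed

lemma symf_disjoint_support:
  assumes "T1 \<subseteq> {..<n}" "T2 \<subseteq> {..<n}" "T1 \<inter> T2 = {}"
    and "u \<in> mod_box q (coords_on n T1)" "v \<in> mod_box q (coords_on n T2)"
  shows "symf n u v = 0"
  unfolding symf_def
proof (rule sum.neutral, intro ballI)
  fix t assume "t \<in> {..<n}"
  have "(u t = 0 \<and> u (n + t) = 0) \<or> (v t = 0 \<and> v (n + t) = 0)"
  proof (cases "t \<in> T1")
    case True
    then have "t \<notin> coords_on n T2" "n + t \<notin> coords_on n T2"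
      using assms(2,3) \<open>t \<in> {..<n}\<close> by (auto simp: coords_on_def)
    then show ?thesis using assms(5) by (auto simp: mod_box_def split: if_splits)
  next
    case False
    then have "t \<notin> coords_on n T1" "n + t \<notin> coords_on n T1"
      using assms(1) \<open>t \<in> {..<n}\<close> by (auto simp: coords_on_def)
    then show ?thesis using assms(4) by (auto simp: mod_box_def split: if_splits)
  qed
  then show "u t * v (n + t) - v t * u (n + t) = 0" by auto
qed

text \<open>If two disjoint sets \<open>T1\<close>, \<open>T2\<close> of qudits both support only trivial
  logical operators, then \<open>card S * card (S on T2) \<ge> card (S on T1) * q ^ (2 * card T2)\<close> and
  symmetrically, which forces \<open>card T1 + card T2 \<le> r\<close>.\<close>

lemma quantum_singleton:
  assumes q: "prime q" and "r < n"
  shows "\<exists>T v. T \<subseteq> {..<n} \<and> card T \<le> r div 2 + 1 \<and> v \<in> mod_box q (coords_on n T)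
    \<and> (\<forall>s\<in>mod_span q n r g. q dvd symf n s v) \<and> v \<notin> mod_span q n r g"
proof (rule ccontr)
  assume contr: "\<not> ?thesis"
  have q0: "q > 0" using q by (simp add: prime_gt_0_int)
  let ?S = "mod_span q n r g"
  let ?on = "\<lambda>T. ?S \<inter> mod_box q (coords_on n T)"
  have finS: "finite ?S" using mod_space_mod_span[OF q0] by (simp add: mod_space_def)
  have "(\<lambda>i. 0) \<in> ?S"
    unfolding mod_span_def by (rule range_eqI[where x = "\<lambda>j. 0"]) (simp add: fun_eq_iff)
  then have zero: "(\<lambda>i. 0) \<in> ?on T" for T
    using q0 by (simp add: mod_box_def)
  have key: "card (?on T1) * nat q ^ (2 * card T2) \<le> card (?on T2) * nat q ^ r"
    if T: "T1 \<subseteq> {..<n}" "T2 \<subseteq> {..<n}" "T1 \<inter> T2 = {}" "card T2 \<le> r div 2 + 1" for T1 T2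
  proof -
    let ?B = "mod_box q (coords_on n T2)"
    have lin: "[symf n z (\<lambda>i. (x i + c * y i) mod q) = symf n z x + c * symf n z y] (mod q)"
      "[symf n (\<lambda>i. (x i + c * y i) mod q) z = symf n x z + c * symf n y z] (mod q)" for x y z c
      unfolding symf_add_left[symmetric] symf_add_right[symmetric]
      by (rule symf_vcong; simp add: vcong_def)+
    \<comment> \<open>Vectors on disjoint sets of qudits commute, so the span elements on
      \<open>T1\<close> lie in the radical of the pairing between the span and the box on
      \<open>T2\<close>.\<close>
    have "card (?on T1) * card ?B \<le> card {x \<in> ?S. \<forall>y\<in>?B. q dvd symf n x y} * card ?B"
      using symf_disjoint_support[OF T(1-3)] finS by (intro mult_right_mono card_mono) auto
    also have "\<dots> = card {y \<in> ?B. \<forall>x\<in>?S. q dvd symf n x y} * card ?S"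
      by (rule card_radicals[OF q mod_space_mod_span[OF q0]
            mod_space_mod_box[OF card_coords_on(2)[OF T(2)] q0] lin])
    \<comment> \<open>By \<open>contr\<close>, every vector on \<open>T2\<close> that commutes with
      the span already belongs to it.\<close>
    also have "\<dots> \<le> card (?on T2) * nat q ^ r"
      using contr T(2,4) finS card_mod_span_le[OF q0, of n r g]
      by (intro mult_mono card_mono) auto
    finally show ?thesis using card_coords_on[OF T(2)] by (simp add: card_mod_box)
  qed
  \<comment> \<open>Since \<open>r < n\<close>, there are \<open>r + 1\<close> qudits to split into
    two blocks of at most \<open>r div 2 + 1\<close> each.\<close>
  define a where "a = r div 2 + 1"
  have "card (?on {..<a}) * nat q ^ (2 * card {a..<r+1}) \<le> card (?on {a..<r+1}) * nat q ^ r"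
    using \<open>r < n\<close> by (intro key) (auto simp: a_def)
  moreover have "card (?on {a..<r+1}) * nat q ^ (2 * card {..<a}) \<le> card (?on {..<a}) * nat q ^ r"
    using \<open>r < n\<close> by (intro key) (auto simp: a_def)
  \<comment> \<open>In the product of the two inequalities the unknown counts of span elements on
    the blocks cancel, being positive; what remains compares the exponents 2(r + 1) and 2r.\<close>
  ultimately have "(card (?on {..<a}) * nat q ^ (2 * (r + 1 - a))) * (card (?on {a..<r+1}) * nat q ^ (2 * a))
    \<le> (card (?on {a..<r+1}) * nat q ^ r) * (card (?on {..<a}) * nat q ^ r)"
    unfolding card_lessThan card_atLeastLessThan by (rule mult_le_mono)
  moreover have "card (?on T) > 0" for T
    using zero[of T] finS by (auto simp: card_gt_0_iff)
  moreover have "u * w \<le> s * t" if "(a * u) * (b * w) \<le> (b * s) * (a * t)" "a > 0" "b > 0"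
    for a b s t u w :: nat
  proof -
    have "(a * b) * (u * w) \<le> (a * b) * (s * t)" using that(1) by (simp only: ac_simps)
    then show ?thesis using that(2,3) by simp
  qed
  ultimately have "nat q ^ (2 * (r + 1 - a)) * nat q ^ (2 * a) \<le> nat q ^ r * nat q ^ r"
    by (metis (no_types, lifting))
  then have "nat q ^ (2 * (r + 1 - a) + 2 * a) \<le> nat q ^ (r + r)" by (simp only: power_add)
  then have "2 * (r + 1 - a) + 2 * a \<le> r + r"
    by (rule power_le_imp_le_exp[rotated]) (use prime_gt_1_int[OF q] in simp)
  then show False by (simp add: a_def)
qed

section \<open>Lifting a code to the integers\<close>

lemma symf_unit_vec: "j < n \<Longrightarrow> symf n v (unit_vec j) = - v (n + j)"
proof -
  assume "j < n"
  have "symf n v (unit_vec j) = (\<Sum>t<n. if t = j then - v (n + t) else 0)"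
    unfolding symf_def using \<open>j < n\<close> by (intro sum.cong refl) (auto simp: unit_vec_def)
  then show ?thesis using \<open>j < n\<close> by (simp add: sum.delta)
qed

lemma sum_unit_vec: "(\<Sum>j<r. c j * unit_vec j i) = (if i < r then c i else 0)"
proof -
  have "(\<Sum>j<r. c j * unit_vec j i) = (\<Sum>j<r. if j = i then c j else 0)"
    by (intro sum.cong) (auto simp: unit_vec_def)
  then show ?thesis by (simp add: sum.delta)
qed

lemma unit_vec_indep: "r \<le> n \<Longrightarrow> lin_indep_mod q n r unit_vec"
  unfolding lin_indep_mod_def sum_unit_vec
proof (intro allI impI)
  fix c :: "nat \<Rightarrow> int" and j assume "r \<le> n" "\<forall>i<2*n. q dvd (if i < r then c i else 0)" "j < r"
  then show "q dvd c j" by (auto dest: spec[of _ j])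
qed

lemma unit_vec_isotropic: "r \<le> n \<Longrightarrow> isotropic_mod q n r unit_vec"
  by (auto simp: isotropic_mod_def symf_unit_vec) (simp add: unit_vec_def)

lemma lin_indep_mod_vcong:
  assumes "lin_indep_mod q n r x" "\<And>j. j < r \<Longrightarrow> vcong q n (y j) (x j)"
  shows "lin_indep_mod q n r y"
  unfolding lin_indep_mod_def
proof (intro allI impI)
  fix c :: "nat \<Rightarrow> int" and j assume *: "\<forall>i<2*n. q dvd (\<Sum>j<r. c j * y j i)" "j < r"
  have "q dvd (\<Sum>j<r. c j * x j i)" if "i < 2*n" for i
  proof -
    have "[(\<Sum>j<r. c j * y j i) = (\<Sum>j<r. c j * x j i)] (mod q)"
      using assms(2) that by (intro cong_sum cong_mult) (auto simp: vcong_def)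
    then show ?thesis using * that cong_dvd_iff by blast
  qed
  then show "q dvd c j" using assms(1) *(2) unfolding lin_indep_mod_def by blast
qed

text \<open>The weight bound modulo the auxiliary prime \<open>p\<close> passes to integer vectors by dividing out \<open>p\<close>.\<close>

lemma ldi_frame_exists:
  assumes q: "prime q" and "r < n"
    and g: "lin_indep_mod q n r g" "isotropic_mod q n r g"
  obtains G where "G \<in> transvections n 1"
    "\<And>j. j < r \<Longrightarrow> vcong q n (G (unit_vec j)) (g j)"
    "\<And>v i. \<lbrakk>\<And>j. j < r \<Longrightarrow> symf n v (G (unit_vec j)) = 0;
       card {t. t < n \<and> (v t \<noteq> 0 \<or> v (n + t) \<noteq> 0)} \<le> r div 2; i < 2*n\<rbrakk> \<Longrightarrow> v i = 0"
proof -
  \<comment> \<open>Exceeding \<open>n\<close> keeps the evaluation points distinct and the weights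
    units modulo \<open>p\<close>; exceeding \<open>q\<close> makes the two primes coprime.\<close>
  obtain p0 where p0: "prime p0" "p0 > max n (nat q)" using bigger_prime by blast
  define p where "p = int p0"
  have p: "prime p" "int n \<le> p" "p \<noteq> q" using p0 by (auto simp: p_def)
  have cop: "coprime q p" "coprime p q" using primes_coprime[of q p] p q by (auto simp: coprime_commute)
  let ?R = "rs_frame n (r div 2)"
  have R: "lin_indep_mod p n r ?R" "isotropic_mod p n r ?R"
    using \<open>r < n\<close> p(1,2) by (auto intro!: rs_frame_indep simp: isotropic_mod_def symf_rs_frame)
  have le: "r \<le> n" using \<open>r < n\<close> by simp
  \<comment> \<open>The multipliers are divisible by \<open>q\<close>, so modulo \<open>q\<close>
    the frame is still the standard one and remains eligible for the second move.\<close>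
  obtain G1 where G1: "G1 \<in> transvections n q" "\<And>j. j < r \<Longrightarrow> vcong p n (G1 (unit_vec j)) (?R j)"
    using transvections_transitive[OF p(1) cop(1) unit_vec_indep[OF le] unit_vec_isotropic[OF le] R]
    by blast
  define x where "x j = G1 (unit_vec j)" for j
  have "lin_indep_mod q n r x"
    using lin_indep_mod_vcong[OF unit_vec_indep[OF le], of q x] transvections_vcong_self[OF G1(1)]
    by (simp add: x_def)
  moreover have "isotropic_mod q n r x"
    using unit_vec_isotropic[OF le, of q] by (simp add: isotropic_mod_def x_def transvections_symf[OF G1(1)])
  \<comment> \<open>Here the multipliers are divisible by \<open>p\<close>, which leaves the
    position reached modulo \<open>p\<close> untouched.\<close>
  ultimately obtain G2 where G2: "G2 \<in> transvections n p" "\<And>j. j < r \<Longrightarrow> vcong q n (G2 (x j)) (g j)"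
    using transvections_transitive[OF q cop(2) _ _ g] by blast
  define G where "G v = G2 (G1 v)" for v
  have "G \<in> transvections n 1"
    using transvections_comp[OF transvections_mono[OF G2(1)] transvections_mono[OF G1(1)]]
    by (simp add: G_def[abs_def])
  moreover have "vcong q n (G (unit_vec j)) (g j)" if "j < r" for j
    using G2(2)[OF that] by (simp add: G_def x_def)
  moreover have "v i = 0"
    if v: "\<And>j. j < r \<Longrightarrow> symf n v (G (unit_vec j)) = 0"
      "card {t. t < n \<and> (v t \<noteq> 0 \<or> v (n + t) \<noteq> 0)} \<le> r div 2" "i < 2*n" for v i
  proof -
    have GR: "vcong p n (G (unit_vec j)) (?R j)" if "j < r" for j
      using vcong_trans[OF transvections_vcong_self[OF G2(1)] G1(2)[OF that]] by (simp add: G_def)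
    \<comment> \<open>Infinite descent: \<open>v\<close> divided by \<open>p\<close> satisfies the
      same exact equations and has the same support.\<close>
    have pow: "p ^ k dvd v i" for k
      using v(1,2)
    proof (induction k arbitrary: v)
      case (Suc k)
      have dvd: "p dvd v i" if "i < 2*n" for i
      proof (rule rs_frame_perp_weight[OF p(1,2) _ Suc.prems(2) that])
        fix j assume "j < r"
        then show "p dvd symf n v (?R j)"
          using Suc.prems(1) dvd_symf_vcong[OF vcong_refl GR[OF \<open>j < r\<close>], of v] by simp
      qed
      define w where "w i = v i div p" for i
      have vw: "v i = 0 + p * w i" if "i < 2*n" for i using dvd[OF that] by (simp add: w_def)
      have p0: "p \<noteq> 0" using p(1) by auto
      have "symf n w (G (unit_vec j)) = 0" if "j < r" for j
      proof -
        have "symf n v (G (unit_vec j)) = symf n (\<lambda>i. 0 + p * w i) (G (unit_vec j))"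
          by (rule symf_cong) (simp_all add: vw[simplified])
        then show ?thesis using Suc.prems(1)[OF that] p0 unfolding symf_add_left by simp
      qed
      moreover have "{t. t < n \<and> (w t \<noteq> 0 \<or> w (n + t) \<noteq> 0)} = {t. t < n \<and> (v t \<noteq> 0 \<or> v (n + t) \<noteq> 0)}"
        using p0 by (auto simp: vw)
      ultimately have "p ^ k dvd w i" using Suc.IH[of w] Suc.prems(2) by simp
      then show ?case using vw[OF v(3)] by (simp add: mult_dvd_mono)
    qed simp
    show "v i = 0"
    proof (rule ccontr)
      assume "v i \<noteq> 0"
      \<comment> \<open>With m the absolute value of \<open>v i\<close>, the power
        \<open>p ^ m\<close> is at least \<open>2 ^ m\<close> and so exceeds m.\<close>
      then have "\<bar>p ^ nat \<bar>v i\<bar>\<bar> \<le> \<bar>v i\<bar>" using dvd_imp_le_int[OF _ pow] by simp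
      moreover have "2 ^ nat \<bar>v i\<bar> \<le> p ^ nat \<bar>v i\<bar>" using prime_ge_2_int[OF p(1)] by (intro power_mono) auto
      moreover have "int (nat \<bar>v i\<bar>) < 2 ^ nat \<bar>v i\<bar>" using of_nat_less_two_power by blast
      ultimately show False by simp
    qed
  qed
  ultimately show ?thesis using that by blast
qed

text \<open>In coordinates where the frame is the standard X frame, commuting with it kills all Z
  entries modulo \<open>q\<close>, and the X entries are the coefficients sought.\<close>

lemma full_rank_self_dual:
  assumes q: "prime q" and g: "lin_indep_mod q n n g" "isotropic_mod q n n g"
    and v: "\<And>j. j < n \<Longrightarrow> q dvd symf n v (g j)"
  shows "\<exists>c. \<forall>i<2*n. [v i = (\<Sum>j<n. c j * g j i)] (mod q)"
proof -
  obtain G where G: "G \<in> transvections n 1" "\<And>j. j < n \<Longrightarrow> vcong q n (G (unit_vec j)) (g j)"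
    using transvections_transitive[OF q _ unit_vec_indep unit_vec_isotropic g, of 1] by auto
  obtain z where z: "v = G z" using transvections_surj[OF G(1)] by (metis surjD)
  have "q dvd z (n + j)" if "j < n" for j
  proof -
    have "q dvd symf n (G z) (G (unit_vec j))"
      using v[OF that] dvd_symf_vcong[OF vcong_refl G(2)[OF that], of v] by (simp add: z)
    then show ?thesis using symf_unit_vec[OF that, of z] by (simp add: transvections_symf[OF G(1)])
  qed
  then have "q dvd z i" if "n \<le> i" "i < 2*n" for i
    using that by (metis le_add_diff_inverse less_diff_conv2 mult_2)
  then have "vcong q n z (\<lambda>i. \<Sum>j<n. z j * unit_vec j i)"
    unfolding vcong_def sum_unit_vec by (auto simp: cong_0_iff)
  from transvections_vcong[OF G(1) this]
  have *: "vcong q n v (\<lambda>i. \<Sum>j<n. z j * G (unit_vec j) i)"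
    by (simp add: z transvections_sum[OF G(1)])
  have "[v i = (\<Sum>j<n. z j * g j i)] (mod q)" if "i < 2*n" for i
  proof -
    have "[(\<Sum>j<n. z j * G (unit_vec j) i) = (\<Sum>j<n. z j * g j i)] (mod q)"
      using G(2) that by (intro cong_sum cong_mult) (auto simp: vcong_def)
    then show ?thesis using * that cong_trans unfolding vcong_def by blast
  qed
  then show ?thesis by blast
qed

lemma singleton_logical_q:
  assumes q: "prime q" and "length gens < n"
  shows "\<exists>v. logical_q q n gens v \<and> pweight n v \<le> length gens div 2 + 1"
proof -
  let ?r = "length gens" and ?g = "\<lambda>j. (!) (gens ! j)"
  have q0: "q > 0" using q by (simp add: prime_gt_0_int)
  obtain T v where T: "T \<subseteq> {..<n}" "card T \<le> ?r div 2 + 1" and v: "v \<in> mod_box q (coords_on n T)"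
    and comm: "\<And>s. s \<in> mod_span q n ?r ?g \<Longrightarrow> q dvd symf n s v" and notin: "v \<notin> mod_span q n ?r ?g"
    using quantum_singleton[OF assms, of ?g] by blast
  define w where "w = map v [0..<2*n]"
  have w: "w ! i = v i" if "i < 2*n" for i using that by (simp add: w_def)
  have range: "0 \<le> v i \<and> v i < q" for i
    using v q0 by (cases "i \<in> coords_on n T") (auto simp: mod_box_def dest: spec[of _ i])
  have supp: "i \<in> coords_on n T" if "v i \<noteq> 0" for i
    by (rule ccontr) (use v that in \<open>simp add: mod_box_def\<close>)
  have "is_pauli_q q n w" using range by (auto simp: is_pauli_q_def w_def)
  moreover have "symp n w h mod q = 0" if "h \<in> set gens" for h
  proof -
    obtain l where l: "l < ?r" "h = gens ! l"
      using \<open>h \<in> set gens\<close> by (metis in_set_conv_nth)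
    let ?s = "\<lambda>i. if i < 2*n then (\<Sum>j<?r. unit_vec l j * ?g j i) mod q else 0"
    have "?s \<in> mod_span q n ?r ?g" unfolding mod_span_def by (rule rangeI)
    then have "q dvd symf n ?s v" by (rule comm)
    moreover have "(\<Sum>j<?r. unit_vec l j * ?g j i) = h ! i" for i
    proof -
      have "(\<Sum>j<?r. unit_vec l j * ?g j i) = (\<Sum>j<?r. if j = l then ?g j i else 0)"
        by (intro sum.cong) (auto simp: unit_vec_def)
      then show ?thesis using l by (simp add: sum.delta)
    qed
    then have "vcong q n ?s ((!) h)" by (simp add: vcong_def)
    ultimately have "q dvd symf n ((!) h) v" using dvd_symf_vcong[OF _ vcong_refl] by blast
    moreover have "symp n w h = - symf n ((!) h) v"
      unfolding symp_eq_symf symf_swap[of n "(!) w"] by (simp add: symf_cong[OF refl w])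
    ultimately show ?thesis by (simp add: dvd_eq_mod_eq_0[symmetric])
  qed
  moreover have "\<not> in_stab_q q n gens w"
  proof
    assume "in_stab_q q n gens w"
    then obtain c where c: "\<And>i. i < 2*n \<Longrightarrow> v i mod q = (\<Sum>j<?r. c j * ?g j i) mod q"
      by (auto simp: in_stab_q_def w)
    have "v = (\<lambda>i. if i < 2*n then (\<Sum>j<?r. c j * ?g j i) mod q else 0)"
    proof
      fix i
      show "v i = (if i < 2*n then (\<Sum>j<?r. c j * ?g j i) mod q else 0)"
      proof (cases "i < 2*n")
        case True
        then show ?thesis using c[OF True] range[of i] by simp
      next
        case False
        then have "i \<notin> coords_on n T" using T(1) by (auto simp: coords_on_def)
        then show ?thesis using v False by (auto simp: mod_box_def)
      qed
    qed
    then show False using notin unfolding mod_span_def by blast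
  qed
  moreover have "pweight n w \<le> card T"
    unfolding pweight_def
  proof (rule card_mono)
    show "finite T" using T(1) finite_subset by blast
    show "{t. t < n \<and> (w ! t \<noteq> 0 \<or> w ! (n + t) \<noteq> 0)} \<subseteq> T"
    proof
      fix t assume t: "t \<in> {t. t < n \<and> (w ! t \<noteq> 0 \<or> w ! (n + t) \<noteq> 0)}"
      then have "v t \<noteq> 0 \<or> v (n + t) \<noteq> 0" "t < n" using w by auto
      then have "t \<in> coords_on n T \<or> n + t \<in> coords_on n T"
        using supp by blast
      then show "t \<in> T" using T(1) \<open>t < n\<close> by (auto simp: coords_on_def)
    qed
  qed
  ultimately show ?thesis unfolding logical_q_def using T(2) le_trans by blast
qed

theorem theorem7:
  fixes q :: int and n k d :: nat and gens :: "int list list"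
  assumes "prime q"
    and "stab_code_q q n k gens"
    and "has_distance_q q n gens d"
  shows "\<exists>L. LDI_form q n gens L \<and> stab_code_Z n k L
            \<and> has_distance_Z n L (d_star n L) \<and> d \<le> d_star n L"
proof -
  note q = assms(1)
  define r where "r = n - k"
  define g where "g j = (!) (gens ! j)" for j
  have kn: "k \<le> n" and len: "length gens = r"
    using assms(2) by (auto simp: stab_code_q_def r_def)
  have indep: "lin_indep_mod q n r g"
    using assms(2) by (simp add: stab_code_q_def indep_q_def lin_indep_mod_def g_def len dvd_eq_mod_eq_0)
  have iso: "isotropic_mod q n r g"
    using assms(2) by (simp add: stab_code_q_def isotropic_mod_def g_def len dvd_eq_mod_eq_0
        flip: symp_eq_symf)
  \<comment> \<open>The existence of a distance supplies a logical operator, which a self-dual code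
    lacks.\<close>
  have "r < n"
  proof (rule ccontr)
    assume "\<not> r < n"
    then have rn: "r = n" by (simp add: r_def)
    obtain v where v: "logical_q q n gens v" using assms(3) by (auto simp: has_distance_q_def)
    have "q dvd symf n ((!) v) (g j)" if "j < n" for j
      using v that by (simp add: logical_q_def g_def len rn dvd_eq_mod_eq_0 flip: symp_eq_symf)
    from full_rank_self_dual[OF q indep[unfolded rn] iso[unfolded rn] this]
    have "in_stab_q q n gens v" by (simp add: in_stab_q_def cong_def g_def len rn)
    then show False using v by (simp add: logical_q_def)
  qed
  obtain G where G: "G \<in> transvections n 1"
    and Gg: "\<And>j. j < r \<Longrightarrow> vcong q n (G (unit_vec j)) (g j)"
    and Gwt: "\<And>v i. \<lbrakk>\<And>j. j < r \<Longrightarrow> symf n v (G (unit_vec j)) = 0;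
       card {t. t < n \<and> (v t \<noteq> 0 \<or> v (n + t) \<noteq> 0)} \<le> r div 2; i < 2*n\<rbrakk> \<Longrightarrow> v i = 0"
    using ldi_frame_exists[OF q \<open>r < n\<close> indep iso] by blast
  define L where "L = map (\<lambda>j. map (G (unit_vec j)) [0..<2*n]) [0..<r]"
  have lenL: "length L = r" by (simp add: L_def)
  have L: "L ! j ! i = G (unit_vec j) i" if "j < r" "i < 2*n" for i j
    using that by (simp add: L_def)
  have setL: "h \<in> set L \<Longrightarrow> \<exists>j<r. h = L ! j" for h
    using lenL by (metis in_set_conv_nth)
  have sympL: "symp n v (L ! j) = symf n ((!) v) (G (unit_vec j))" if "j < r" for v j
    unfolding symp_eq_symf by (rule symf_cong) (simp_all add: L[OF that])
  have isoL: "symp n (L ! i) (L ! j) = 0" if "i < r" "j < r" for i j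
  proof -
    have "symp n (L ! i) (L ! j) = symf n (G (unit_vec i)) (G (unit_vec j))"
      unfolding sympL[OF that(2)] by (rule symf_cong) (simp_all add: L[OF that(1)])
    also have "\<dots> = 0"
      using that \<open>r < n\<close> by (simp add: transvections_symf[OF G] symf_unit_vec) (simp add: unit_vec_def)
    finally show ?thesis .
  qed
  \<comment> \<open>The vectors \<open>G (coord_vec n l)\<close> form a dual frame over the
    integers. Reading coefficients with it gives independence for \<open>l < r\<close>, and at
    \<open>l = r\<close> it detects a vector outside the stabilizer.\<close>
  have comb: "symf n (\<lambda>i. \<Sum>j<r. c j * L ! j ! i) (G (coord_vec n l)) = (if l < r then c l else 0)"
    if "l < 2*n" for c l
  proof -
    have "symf n (\<lambda>i. \<Sum>j<r. c j * L ! j ! i) (G (coord_vec n l))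
        = symf n (\<lambda>i. \<Sum>j<r. c j * G (unit_vec j) i) (G (coord_vec n l))"
      by (rule symf_cong) (simp_all add: L)
    also have "\<dots> = symf n (\<lambda>i. \<Sum>j<r. c j * unit_vec j i) (coord_vec n l)"
      unfolding transvections_sum[OF G, symmetric] transvections_symf[OF G] ..
    also have "\<dots> = (if l < r then c l else 0)"
      unfolding symf_coord[OF that] sum_unit_vec ..
    finally show ?thesis .
  qed
  have "LDI_form q n gens L"
    unfolding LDI_form_def
  proof (intro conjI ballI)
    show "\<forall>j<length L. length (L ! j) = 2*n \<and> (\<forall>i<2*n. L ! j ! i mod q = gens ! j ! i mod q)"
      using Gg by (simp add: lenL L vcong_def cong_def g_def) (simp add: L_def)
    show "symp n h h' = 0" if "h \<in> set L" "h' \<in> set L" for h h'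
      using setL isoL that by blast
  qed (simp add: lenL len)
  moreover have "stab_code_Z n k L"
    unfolding stab_code_Z_def
  proof (intro conjI ballI)
    show "indep_Z n L"
      unfolding indep_Z_def lenL
    proof (intro allI impI)
      fix c :: "nat \<Rightarrow> int" and l
      assume *: "\<forall>i<2*n. (\<Sum>j<r. c j * L ! j ! i) = 0" and "l < r"
      have "symf n (\<lambda>i. \<Sum>j<r. c j * L ! j ! i) (G (coord_vec n l)) = symf n (\<lambda>i. 0) (G (coord_vec n l))"
        by (rule symf_cong) (simp_all add: *)
      then show "c l = 0" using comb[of l c] \<open>l < r\<close> \<open>r < n\<close> by simp
    qed
    show "length h = 2*n" if "h \<in> set L" for h using that by (auto simp: L_def)
    show "symp n h h' = 0" if "h \<in> set L" "h' \<in> set L" for h h'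
      using setL isoL that by blast
  qed (use kn in \<open>simp_all add: lenL r_def\<close>)
  moreover
  have ue: "unavoidable_error n L v \<longleftrightarrow> logical_Z n L v" for v
    by (auto simp: unavoidable_error_def logical_Z_def)
  \<comment> \<open>Without a witness the \<open>LEAST\<close> in \<open>d_star\<close> would be
    unspecified. The image of X on qudit \<open>r\<close>, which exists since \<open>r < n\<close>,
    commutes with the frame and has a nonzero component outside its span.\<close>
  have ex: "\<exists>v. logical_Z n L v"
  proof
    let ?v = "map (G (unit_vec r)) [0..<2*n]"
    have "symp n ?v h = 0" if "h \<in> set L" for h
    proof -
      obtain j where j: "j < r" "h = L ! j" using setL \<open>h \<in> set L\<close> by blast
      have "symp n ?v h = symf n (G (unit_vec r)) (G (unit_vec j))"
        unfolding j(2) sympL[OF j(1)] by (rule symf_cong) simp_all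
      then show ?thesis using j(1) \<open>r < n\<close>
        by (simp add: transvections_symf[OF G] symf_unit_vec) (simp add: unit_vec_def)
    qed
    moreover have "\<not> in_stab_Z n L ?v"
    proof
      assume "in_stab_Z n L ?v"
      then obtain c where c: "\<And>i. i < 2*n \<Longrightarrow> G (unit_vec r) i = (\<Sum>j<r. c j * L ! j ! i)"
        by (auto simp: in_stab_Z_def lenL)
      have "symf n (G (unit_vec r)) (G (coord_vec n r))
          = symf n (\<lambda>i. \<Sum>j<r. c j * L ! j ! i) (G (coord_vec n r))"
        by (rule symf_cong) (simp_all add: c)
      then show False using \<open>r < n\<close>
        by (simp add: comb transvections_symf[OF G] symf_coord) (simp add: unit_vec_def)
    qed
    ultimately show "logical_Z n L ?v" by (simp add: logical_Z_def)
  qed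
  have "has_distance_Z n L (d_star n L)"
    unfolding has_distance_Z_def d_star_def ue
    using LeastI_ex[of "\<lambda>w. \<exists>v. logical_Z n L v \<and> pweight n v = w"] ex by (auto intro: Least_le)
  moreover have "d \<le> d_star n L"
  proof -
    obtain v where v: "logical_Z n L v" "pweight n v = d_star n L"
      using \<open>has_distance_Z n L (d_star n L)\<close> by (auto simp: has_distance_Z_def)
    \<comment> \<open>Purity enters here: a commuting vector of smaller weight is zero, hence a
      stabilizer rather than an error.\<close>
    have "r div 2 < pweight n v"
    proof (rule ccontr)
      assume "\<not> r div 2 < pweight n v"
      moreover have "symf n ((!) v) (G (unit_vec j)) = 0" if "j < r" for j
        using v(1) lenL that by (simp add: logical_Z_def flip: sympL[OF that])
      ultimately have "v ! i = 0" if "i < 2*n" for i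
        using Gwt[of "(!) v" i] that by (simp add: pweight_def)
      then have "in_stab_Z n L v" by (auto simp: in_stab_Z_def intro!: exI[of _ "\<lambda>j. 0"])
      then show False using v(1) by (simp add: logical_Z_def)
    qed
    moreover have "d \<le> r div 2 + 1"
      using singleton_logical_q[OF q, of gens n] assms(3) \<open>r < n\<close> len le_trans
      unfolding has_distance_q_def by metis
    ultimately show ?thesis using v(2) by simp
  qed
  ultimately show ?thesis by blast
qed

end
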